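(* Let $G=(V,E,J)$ be a connected transitive weighted graph and let $\Gamma\subseteq\mathrm{Aut}(G)$ be a closed, transitive, unimodular subgroup. Let $\mu$ be a $\Gamma$-invariant probability measure on $[0,1]^E$. Then for every $h>0$, \[ \mathbb E_{\mu,h}\Bigl[\mathbb 1(\mathscr T_\eta)\sqrt{\tfrac{\mathbf p_\eta}{(1-\mathbf p_\eta)J_\eta}}\Bigr]\le 21\sqrt h, \] where the integrand is interpreted as $0$ when $\mathbf p_\eta=1$.
   Context: Weighted graph: countable graph with positive edge weights $J_e$, $\sum_{e\ni v}J_e<\infty$ for each $v$; automorphisms preserve $J$. $\Gamma$ acts on $[0,1]^E$ by $(\gamma\mathbf p)_e=\mathbf p_{\gamma^{-1}e}$. Percolation in random environment: $\mathbf p=(\mathbf p_e)$ has law $\mu$; independent i.i.d. Uniform$[0,1]$ variables $(U_e)$; $\omega(e)=\mathbb 1(U_e\le\mathbf p_e)$; edges with $\omega(e)=1$ are open. Ghost field: conditionally on $\mathbf p$, independently of $\omega$, each edge $e$ is declared green independently with probability $1-e^{-hJ_e}$. Fix a vertex $o$; $\eta$ is an oriented edge emanating from $o$, chosen independently of everything else with probability proportional to $J_e$. $\mathbb E_{\mu,h}$ is expectation for the joint law of $(\mathbf p,\omega,\text{ghost field},\eta)$. A cluster (connected component of the open subgraph) touches an edge if the edge has an endpoint in the cluster. $\mathscr T_e$ is the event that $e$ is closed and its endpoints lie in distinct clusters of $\omega$, each of which touches some green edge, and at least one of which is finite. *)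

theory Defs
  imports "HOL-Probability.Probability"
begin

text \<open>Weighted graphs: vertices form a countable type; edges are 2-element vertex sets;
  the weight function J is defined on all vertex sets, an edge being a set of positive weight.\<close>

definition weighted_graph :: "('v set \<Rightarrow> real) \<Rightarrow> bool" where
  "weighted_graph J \<longleftrightarrow> (\<forall>e. J e \<ge> 0) \<and> (\<forall>e. J e \<noteq> 0 \<longrightarrow> (\<exists>x y. x \<noteq> y \<and> e = {x, y}))
     \<and> (\<forall>v. (\<lambda>y. J {v, y}) summable_on UNIV)"

definition edges :: "('v set \<Rightarrow> real) \<Rightarrow> 'v set set" where
  "edges J = {e. J e > 0}"

definition adj :: "('v set \<Rightarrow> real) \<Rightarrow> ('v \<times> 'v) set" where
  "adj J = {(x, y). J {x, y} > 0}"

definition connected_wg :: "('v set \<Rightarrow> real) \<Rightarrow> bool" where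
  "connected_wg J \<longleftrightarrow> (\<forall>x y. (x, y) \<in> (adj J)\<^sup>*)"

definition is_aut :: "('v set \<Rightarrow> real) \<Rightarrow> ('v \<Rightarrow> 'v) \<Rightarrow> bool" where
  "is_aut J \<gamma> \<longleftrightarrow> bij \<gamma> \<and> (\<forall>e. J (\<gamma> ` e) = J e)"

definition transitive_group :: "('v \<Rightarrow> 'v) set \<Rightarrow> bool" where
  "transitive_group \<Gamma> \<longleftrightarrow> (\<forall>x y. \<exists>\<gamma>\<in>\<Gamma>. \<gamma> x = y)"

definition transitive_wg :: "('v set \<Rightarrow> real) \<Rightarrow> bool" where
  "transitive_wg J \<longleftrightarrow> transitive_group {\<gamma>. is_aut J \<gamma>}"

text \<open>Closed subgroup of Aut(G), Aut(G) carrying the topology of pointwise convergence.\<close>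
definition closed_aut_subgroup :: "('v set \<Rightarrow> real) \<Rightarrow> ('v \<Rightarrow> 'v) set \<Rightarrow> bool" where
  "closed_aut_subgroup J \<Gamma> \<longleftrightarrow>
     \<Gamma> \<subseteq> {\<gamma>. is_aut J \<gamma>} \<and> id \<in> \<Gamma> \<and> (\<forall>a\<in>\<Gamma>. \<forall>b\<in>\<Gamma>. a \<circ> b \<in> \<Gamma>) \<and> (\<forall>a\<in>\<Gamma>. inv a \<in> \<Gamma>)
     \<and> (\<forall>\<gamma>. is_aut J \<gamma> \<and> (\<forall>F. finite F \<longrightarrow> (\<exists>\<gamma>'\<in>\<Gamma>. \<forall>x\<in>F. \<gamma>' x = \<gamma> x)) \<longrightarrow> \<gamma> \<in> \<Gamma>)"

text \<open>Orbit of y under the stabiliser of x; unimodularity: |Stab_x y| = |Stab_y x|.\<close>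
definition stab_orbit :: "('v \<Rightarrow> 'v) set \<Rightarrow> 'v \<Rightarrow> 'v \<Rightarrow> 'v set" where
  "stab_orbit \<Gamma> x y = {\<gamma> y | \<gamma>. \<gamma> \<in> \<Gamma> \<and> \<gamma> x = x}"

definition unimodular :: "('v \<Rightarrow> 'v) set \<Rightarrow> bool" where
  "unimodular \<Gamma> \<longleftrightarrow> (\<forall>x y. card (stab_orbit \<Gamma> x y) = card (stab_orbit \<Gamma> y x))"

text \<open>The measurable space [0,1]^E and the action of automorphisms on it.\<close>
definition env_space :: "('v set \<Rightarrow> real) \<Rightarrow> ('v set \<Rightarrow> real) measure" where
  "env_space J = PiM (edges J) (\<lambda>_. restrict_space borel {0..1::real})"

definition act :: "('v set \<Rightarrow> real) \<Rightarrow> ('v \<Rightarrow> 'v) \<Rightarrow> ('v set \<Rightarrow> real) \<Rightarrow> ('v set \<Rightarrow> real)" where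
  "act J \<gamma> p = (\<lambda>e\<in>edges J. p (inv \<gamma> ` e))"

definition invariant_env :: "('v set \<Rightarrow> real) \<Rightarrow> ('v \<Rightarrow> 'v) set \<Rightarrow> ('v set \<Rightarrow> real) measure \<Rightarrow> bool" where
  "invariant_env J \<Gamma> \<mu> \<longleftrightarrow> prob_space \<mu> \<and> sets \<mu> = sets (env_space J)
     \<and> (\<forall>\<gamma>\<in>\<Gamma>. distr \<mu> (env_space J) (act J \<gamma>) = \<mu>)"

text \<open>Independent Uniform[0,1] variables indexed by the edges.\<close>
definition unif_edges :: "('v set \<Rightarrow> real) \<Rightarrow> ('v set \<Rightarrow> real) measure" where
  "unif_edges J = PiM (edges J) (\<lambda>_. uniform_measure lborel {0..1::real})"

text \<open>Law of the endpoint y of the oriented edge eta = (o,y): probability proportional to J.\<close>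
definition eta_law :: "('v set \<Rightarrow> real) \<Rightarrow> 'v \<Rightarrow> 'v measure" where
  "eta_law J x0 = density (count_space UNIV) (\<lambda>y. ennreal (J {x0, y} / (\<Sum>\<^sub>\<infinity>z. J {x0, z})))"

text \<open>Clusters of the open subgraph of omega, and the event T_e for e = {x,y}.\<close>
definition open_rel :: "('v set \<Rightarrow> real) \<Rightarrow> ('v set \<Rightarrow> bool) \<Rightarrow> ('v \<times> 'v) set" where
  "open_rel J \<omega> = {(a, b). J {a, b} > 0 \<and> \<omega> {a, b}}"

definition cluster :: "('v set \<Rightarrow> real) \<Rightarrow> ('v set \<Rightarrow> bool) \<Rightarrow> 'v \<Rightarrow> 'v set" where
  "cluster J \<omega> x = {z. (x, z) \<in> (open_rel J \<omega>)\<^sup>*}"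

definition touches_green :: "('v set \<Rightarrow> real) \<Rightarrow> ('v set \<Rightarrow> bool) \<Rightarrow> 'v set \<Rightarrow> bool" where
  "touches_green J green C \<longleftrightarrow> (\<exists>f. J f > 0 \<and> green f \<and> f \<inter> C \<noteq> {})"

definition T_event :: "('v set \<Rightarrow> real) \<Rightarrow> ('v set \<Rightarrow> bool) \<Rightarrow> ('v set \<Rightarrow> bool) \<Rightarrow> 'v \<Rightarrow> 'v \<Rightarrow> bool" where
  "T_event J \<omega> green x y \<longleftrightarrow> \<not> \<omega> {x, y} \<and> cluster J \<omega> x \<noteq> cluster J \<omega> y
     \<and> touches_green J green (cluster J \<omega> x) \<and> touches_green J green (cluster J \<omega> y)
     \<and> (finite (cluster J \<omega> x) \<or> finite (cluster J \<omega> y))"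

text \<open>E_{mu,h}[F(p, omega, green, eta)] with omega(e) = 1(U_e <= p_e),
  green(e) = 1(V_e <= 1 - exp(-h J_e)), U, V independent uniform families, eta = (o,y).\<close>
definition E_muh :: "('v set \<Rightarrow> real) \<Rightarrow> 'v \<Rightarrow> ('v set \<Rightarrow> real) measure \<Rightarrow> real
     \<Rightarrow> (('v set \<Rightarrow> real) \<Rightarrow> ('v set \<Rightarrow> bool) \<Rightarrow> ('v set \<Rightarrow> bool) \<Rightarrow> 'v \<Rightarrow> ennreal) \<Rightarrow> ennreal" where
  "E_muh J x0 \<mu> h F =
     (\<integral>\<^sup>+ (p, u, g, y). F p (\<lambda>e. u e \<le> p e) (\<lambda>e. g e \<le> 1 - exp (- h * J e)) y
        \<partial>(\<mu> \<Otimes>\<^sub>M (unif_edges J \<Otimes>\<^sub>M (unif_edges J \<Otimes>\<^sub>M eta_law J x0))))"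

end

theory Submission
  imports Defs
begin

text \<open>Give an edge \<open>e\<close> with \<open>J e \<ge> \<epsilon>\<close> touching a cluster the weight \<open>\<surd>(J p / (1 - p))\<close> if it is closed
  and \<open>-\<surd>(J (1 - p) / p)\<close> if it is open: it has mean zero and variance at most \<open>J e\<close>. Opening a
  closed edge merges the clusters of its endpoints, so the expected signed weight of an edge, times
  the number of finite green clusters touching it, is at least the expected weight on the event
  \<open>T\<close>. Mass transport turns the sum of these quantities over the edges at the root into \<open>2 Z / |K|\<close>,
  where \<open>Z\<close> is the signed weight of the cluster \<open>K\<close> of the root, on the event that \<open>K\<close> is finite
  and green. If \<open>W\<close> is the total weight \<open>J\<close> of the edges touching \<open>K\<close>, then
  \<open>Z\<^sup>2 / (W + a)\<^sup>2 + 1 / (W + a)\<close> is a supermartingale along the exploration of \<open>K\<close>, hence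
  \<open>E |Z| / (W + a) \<le> 1 / \<surd>a\<close>. With \<open>d\<close> the weighted degree, \<open>K\<close> is green with probability at
  most \<open>min 1 (h d |K|)\<close>, and \<open>a = 1 / h\<close> gives the bound \<open>4 \<surd>h\<close>. The cut-off \<open>\<epsilon>\<close> makes all
  sums finite and tends to \<open>0\<close> at the end.\<close>

section \<open>Resampling an edge\<close>

text \<open>For \<open>0 < p < 1\<close>, mean zero and variance \<open>J\<close> determine the two
  edge weights up to a common sign, and the closed one is \<open>J\<close> times the integrand of
  the theorem: averaging over the edge at the root turns that integrand into closed weights divided
  by the degree. Mean zero serves twice. It makes the signed weight of a growing cluster a
  martingale, and it makes the open and the closed state of an edge exchangeable at equal cost in
  the merging inequality. The fluctuation estimates hold for every frozen environment; invariance of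
  \<open>\<mu>\<close> enters only through mass transport.

  The obstacle is that all totals live in \<open>[0, \<infinity>]\<close>. The merging inequality
  compares a closed total with an open total, and the latter can be cancelled only when finite. Its
  expectation is governed by the sum of \<open>sqrt (J * p * (1 - p))\<close> over the neighbours of
  the root, which may diverge although the sum of \<open>J\<close> converges; the cut-off repairs
  this.

  The constant 4 is a product of two factors 2: each edge sends mass from both of its endpoints, and
  \<open>min 1 x * (x + 1) \<le> 2 * x\<close> for \<open>x = h * d * |K|\<close>.\<close>

lemma pred_rtrancl:
  fixes r :: "'a \<Rightarrow> ('v::countable \<times> 'v) set"
  assumes "\<And>a b. Measurable.pred M (\<lambda>x. (a, b) \<in> r x)"
  shows "Measurable.pred M (\<lambda>x. (c, z) \<in> (r x)\<^sup>*)"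
proof -
  note assms[measurable]
  have "Measurable.pred M (\<lambda>x. (c, z) \<in> r x ^^ n)" for n
  proof (induction n arbitrary: z)
    case (Suc n)
    note Suc.IH[measurable]
    have "(\<lambda>x. (c, z) \<in> r x ^^ Suc n) = (\<lambda>x. \<exists>y. (c, y) \<in> r x ^^ n \<and> (y, z) \<in> r x)"
      by (auto simp: fun_eq_iff)
    then show ?case
      by simp
  qed simp
  note this[measurable]
  show ?thesis
    unfolding rtrancl_power by measurable
qed

locale wgraph =
  fixes J :: "'v::countable set \<Rightarrow> real"
  assumes weighted: "weighted_graph J"
begin

abbreviation \<nu> :: "real measure" where "\<nu> \<equiv> uniform_measure lborel {0..1::real}"
abbreviation E :: "'v set set" where "E \<equiv> edges J"
abbreviation U :: "('v set \<Rightarrow> real) measure" where "U \<equiv> unif_edges J"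

lemma J_nonneg: "J e \<ge> 0"
  using weighted by (auto simp: weighted_graph_def)

lemma edgeE:
  assumes "J e > 0" obtains x y where "x \<noteq> y" "e = {x, y}"
  using weighted assms by (auto simp: weighted_graph_def) (metis less_irrefl)

lemma J_summable: "(\<lambda>y. J {v, y}) summable_on UNIV"
  using weighted by (auto simp: weighted_graph_def)

lemma countable_edges: "countable E"
proof (rule countable_subset)
  show "E \<subseteq> (\<lambda>(x, y). {x, y}) ` UNIV"
    by (auto simp: edges_def elim!: edgeE)
qed simp

lemma prob_space_nu: "prob_space \<nu>"
  by (rule prob_space_uniform_measure) auto

lemma prob_space_U: "prob_space U"
  unfolding unif_edges_def by (rule prob_space_PiM) (rule prob_space_nu)

text \<open>Holds for every vertex set: points of the product space are \<open>undefined\<close> off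
  \<open>E\<close>, so such a coordinate is constant. Later measurability goals then need no side
  condition.\<close>

lemma measurable_U_coordinate [measurable]: "(\<lambda>u. u e) \<in> borel_measurable U"
proof (cases "e \<in> E")
  case True
  then show ?thesis
    unfolding unif_edges_def
    using measurable_component_singleton[of e E "\<lambda>_. \<nu>"] by (simp cong: measurable_cong_sets)
next
  case False
  have "(\<lambda>u. u e) \<in> borel_measurable U \<longleftrightarrow> (\<lambda>_. undefined :: real) \<in> borel_measurable U"
    by (rule measurable_cong, rule extensional_arb[OF _ False]) (simp add: unif_edges_def space_PiM PiE_def)
  then show ?thesis by simp
qed

lemma emeasure_nu_le:
  assumes "0 \<le> t" "t \<le> 1"
  shows "emeasure \<nu> {x. x \<le> t} = ennreal t"
proof -
  have "{0..1} \<inter> {x. x \<le> t} = {0..t}" using assms by auto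
  then show ?thesis
    using assms by (simp add: emeasure_uniform_measure divide_ennreal_def)
qed

lemma emeasure_nu_gt:
  assumes "0 \<le> t" "t \<le> 1"
  shows "emeasure \<nu> {x. \<not> x \<le> t} = ennreal (1 - t)"
proof -
  have "{0..1} \<inter> {x. \<not> x \<le> t} = {t<..1}" using assms by auto
  then show ?thesis
    using assms by (simp add: emeasure_uniform_measure divide_ennreal_def del: not_le)
qed

text \<open>Fubini with the coordinate \<open>e\<close> split off: given the others,
  \<open>e\<close> is open with probability \<open>p e\<close>. The right side is again an integral
  over all of \<open>U\<close>, with the state of \<open>e\<close> overwritten, so the identity can
  be iterated and used in both directions.\<close>

lemma nn_integral_resample:
  fixes \<Phi> :: "('v set \<Rightarrow> bool) \<Rightarrow> ennreal"
  assumes e: "e \<in> E" and p: "0 \<le> p e" "p e \<le> 1"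
    and meas: "(\<lambda>u. \<Phi> (\<lambda>f. u f \<le> p f)) \<in> borel_measurable U"
  shows "(\<integral>\<^sup>+u. \<Phi> (\<lambda>f. u f \<le> p f) \<partial>U) =
    (\<integral>\<^sup>+u. ennreal (p e) * \<Phi> ((\<lambda>f. u f \<le> p f)(e := True))
        + ennreal (1 - p e) * \<Phi> ((\<lambda>f. u f \<le> p f)(e := False)) \<partial>U)"
proof -
  interpret nu: prob_space \<nu> by (rule prob_space_nu)
  define E' where "E' = E - {e}"
  define P where "P = PiM E' (\<lambda>_. \<nu>)"
  have E: "E = insert e E'" "e \<notin> E'" using e by (auto simp: E'_def)
  interpret P: prob_space P unfolding P_def by (rule prob_space_PiM) (rule prob_space_nu)
  interpret pair_sigma_finite \<nu> P ..
  have U: "U = distr (\<nu> \<Otimes>\<^sub>M P) U (\<lambda>(x, X). X(e := x))"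
    using distr_pair_PiM_eq_PiM[of E' "\<lambda>_. \<nu>" e] prob_space_nu E
    by (auto simp: unif_edges_def P_def)
  have upd[measurable]: "(\<lambda>(x, X). X(e := x)) \<in> measurable (\<nu> \<Otimes>\<^sub>M P) U"
    unfolding unif_edges_def P_def case_prod_beta'
    by (rule measurable_fun_upd[where J = E']) (use E in \<open>auto intro: measurable_snd measurable_fst\<close>)
  have [measurable]: "(\<lambda>u. u(e := c)) \<in> measurable U U" for c
    unfolding unif_edges_def
    by (rule measurable_fun_upd[where J = E]) (use e in auto)
  have eq: "(\<lambda>f. (u(e := c)) f \<le> p f) = (\<lambda>f. u f \<le> p f)(e := c \<le> p e)" for u c
    by (simp add: fun_eq_iff)
  define H where "H u = ennreal (p e) * \<Phi> ((\<lambda>f. u f \<le> p f)(e := True))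
        + ennreal (1 - p e) * \<Phi> ((\<lambda>f. u f \<le> p f)(e := False))" for u
  have mb: "(\<lambda>u. \<Phi> ((\<lambda>f. u f \<le> p f)(e := b))) \<in> borel_measurable U" for b
  proof -
    \<comment> \<open>Setting \<open>u e\<close> to 0 forces \<open>e\<close> open and setting it to
      2 forces it closed, because \<open>0 \<le> p e \<le> 1 < 2\<close>. Measurability is thus
      inherited from \<open>meas\<close>.\<close>
    have "(\<lambda>u. \<Phi> (\<lambda>f. (u(e := (if b then 0 else 2))) f \<le> p f)) \<in> borel_measurable U"
      by (rule measurable_compose[OF _ meas]) measurable
    then show ?thesis using p unfolding eq by (cases b) auto
  qed
  have [measurable]: "H \<in> borel_measurable U"
    unfolding H_def using mb by measurable
  have "(\<integral>\<^sup>+u. \<Phi> (\<lambda>f. u f \<le> p f) \<partial>U) = (\<integral>\<^sup>+(x, X). \<Phi> (\<lambda>f. (X(e := x)) f \<le> p f) \<partial>(\<nu> \<Otimes>\<^sub>M P))"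
    using meas by (subst U, subst nn_integral_distr) (auto simp: case_prod_beta')
  also have "\<dots> = (\<integral>\<^sup>+X. \<integral>\<^sup>+x. \<Phi> (\<lambda>f. (X(e := x)) f \<le> p f) \<partial>\<nu> \<partial>P)"
  proof (subst nn_integral_snd[symmetric])
    show "(\<lambda>(x, X). \<Phi> (\<lambda>f. (X(e := x)) f \<le> p f)) \<in> borel_measurable (\<nu> \<Otimes>\<^sub>M P)"
      using measurable_compose[OF upd meas] by (simp add: case_prod_beta')
  qed simp
  also have "\<dots> = (\<integral>\<^sup>+X. H X \<partial>P)"
  proof (rule nn_integral_cong)
    fix X
    have "(\<integral>\<^sup>+x. \<Phi> (\<lambda>f. (X(e := x)) f \<le> p f) \<partial>\<nu>) =
      (\<integral>\<^sup>+x. \<Phi> ((\<lambda>f. X f \<le> p f)(e := True)) * indicator {x. x \<le> p e} x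
         + \<Phi> ((\<lambda>f. X f \<le> p f)(e := False)) * indicator {x. \<not> x \<le> p e} x \<partial>\<nu>)"
      unfolding eq by (intro nn_integral_cong) (auto split: split_indicator)
    also have "\<dots> = H X"
      using p by (subst nn_integral_add)
        (auto simp: nn_integral_cmult_indicator emeasure_nu_le emeasure_nu_gt H_def mult.commute[of "ennreal _"] simp del: not_le emeasure_uniform_measure)
    finally show "(\<integral>\<^sup>+x. \<Phi> (\<lambda>f. (X(e := x)) f \<le> p f) \<partial>\<nu>) = H X" .
  qed
  \<comment> \<open>\<open>H\<close> ignores the value at \<open>e\<close>, so integrating over that
    coordinate as well changes nothing and restores the full product.\<close>
  also have "\<dots> = (\<integral>\<^sup>+X. \<integral>\<^sup>+x. H (X(e := x)) \<partial>\<nu> \<partial>P)"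
    unfolding H_def eq by (simp add: nu.emeasure_space_1)
  also have "\<dots> = (\<integral>\<^sup>+(x, X). H (X(e := x)) \<partial>(\<nu> \<Otimes>\<^sub>M P))"
    by (subst nn_integral_snd[symmetric]) (auto simp: case_prod_beta' intro!: measurable_compose[OF upd, unfolded case_prod_beta'])
  also have "\<dots> = (\<integral>\<^sup>+u. H u \<partial>distr (\<nu> \<Otimes>\<^sub>M P) U (\<lambda>(x, X). X(e := x)))"
    by (subst nn_integral_distr) (auto simp: case_prod_beta')
  also have "\<dots> = (\<integral>\<^sup>+u. H u \<partial>U)"
    by (simp flip: U)
  finally show ?thesis by (simp add: H_def)
qed

end

section \<open>Exploring a cluster\<close>

definition reach :: "'v set set \<Rightarrow> ('v set \<Rightarrow> bool) \<Rightarrow> 'v set \<Rightarrow> 'v set" where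
  "reach F w C = {(a, b). {a, b} \<in> F \<and> w {a, b}}\<^sup>* `` C"

definition touched :: "'v set set \<Rightarrow> ('v set \<Rightarrow> bool) \<Rightarrow> 'v set \<Rightarrow> 'v set set" where
  "touched F w C = {e \<in> F. e \<inter> reach F w C \<noteq> {}}"

lemma subset_reach: "C \<subseteq> reach F w C"
  by (auto simp: reach_def)

lemma reach_step: "a \<in> reach F w C \<Longrightarrow> {a, b} \<in> F \<Longrightarrow> w {a, b} \<Longrightarrow> b \<in> reach F w C"
  unfolding reach_def by (auto intro: rtrancl_into_rtrancl)

lemma reach_least:
  assumes "C \<subseteq> D" "\<And>a b. a \<in> D \<Longrightarrow> {a, b} \<in> F \<Longrightarrow> w {a, b} \<Longrightarrow> b \<in> D"
  shows "reach F w C \<subseteq> D"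
proof
  fix z assume "z \<in> reach F w C"
  then obtain c where c: "c \<in> C" "(c, z) \<in> {(a, b). {a, b} \<in> F \<and> w {a, b}}\<^sup>*"
    by (auto simp: reach_def)
  from c(2) show "z \<in> D"
    by (induction rule: rtrancl_induct) (use assms c(1) in auto)
qed

lemma reach_remove_closed: "\<not> w e \<Longrightarrow> reach (F - {e}) w C = reach F w C"
  unfolding reach_def by (rule arg_cong[where f = "\<lambda>r. r\<^sup>* `` C"]) auto

text \<open>An open edge meeting the seeds puts both of its ends into the reached set. Once these
  ends are seeds themselves, the edge gives nothing new.\<close>

lemma reach_remove_open:
  assumes "e \<in> F" "w e" "e = {x, y}" "e \<inter> C \<noteq> {}"
  shows "reach (F - {e}) w (C \<union> e) = reach F w C"
proof
  have "e \<subseteq> reach F w C"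
    using assms subset_reach[of C F w] reach_step[of x F w C y] reach_step[of y F w C x]
    by (auto simp: insert_commute)
  then show "reach (F - {e}) w (C \<union> e) \<subseteq> reach F w C"
    by (intro reach_least) (use subset_reach[of C F w] in \<open>auto intro: reach_step\<close>)
  show "reach F w C \<subseteq> reach (F - {e}) w (C \<union> e)"
  proof (rule reach_least)
    show "C \<subseteq> reach (F - {e}) w (C \<union> e)"
      using subset_reach[of "C \<union> e"] by blast
    fix a b assume *: "a \<in> reach (F - {e}) w (C \<union> e)" "{a, b} \<in> F" "w {a, b}"
    show "b \<in> reach (F - {e}) w (C \<union> e)"
    proof (cases "{a, b} = e")
      case True
      then show ?thesis using subset_reach[of "C \<union> e"] by blast
    next
      case False
      then show ?thesis using * by (auto intro: reach_step)
    qed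
  qed
qed

lemma reach_upd: "e \<notin> F \<Longrightarrow> reach F (w(e := b)) C = reach F w C"
  unfolding reach_def by (rule arg_cong[where f = "\<lambda>r. r\<^sup>* `` C"]) auto

lemma touched_upd: "e \<notin> F \<Longrightarrow> touched F (w(e := b)) C = touched F w C"
  by (simp add: touched_def reach_upd)

lemma touched_closed:
  assumes "e \<in> F" "\<not> w e" "e \<inter> C \<noteq> {}"
  shows "touched F w C = insert e (touched (F - {e}) w C)"
  using assms subset_reach[of C F w] by (auto simp: touched_def reach_remove_closed)

lemma touched_open:
  assumes "e \<in> F" "w e" "e = {x, y}" "e \<inter> C \<noteq> {}"
  shows "touched F w C = insert e (touched (F - {e}) w (C \<union> e))"
  using assms(1,4) subset_reach[of C F w]
  unfolding touched_def reach_remove_open[of e F w x y C, OF assms] by blast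

lemma touched_empty:
  assumes "\<And>e. e \<in> F \<Longrightarrow> e \<inter> C = {}"
  shows "touched F w C = {}"
proof -
  have "reach F w C \<subseteq> C"
    by (rule reach_least) (use assms in auto)
  then show ?thesis using assms by (auto simp: touched_def)
qed

section \<open>The supermartingale potential\<close>

definition potential :: "real \<Rightarrow> real \<Rightarrow> real \<Rightarrow> real" where
  "potential a z s = (z / (s + a))\<^sup>2 + 1 / (s + a)"

lemma potential_nonneg: "s \<ge> 0 \<Longrightarrow> a > 0 \<Longrightarrow> potential a z s \<ge> 0"
  by (simp add: potential_def)

text \<open>Mean zero kills the cross term, so the expected square grows by at most
  \<open>j\<close>. With \<open>t = s + a\<close> the cost \<open>j / (t + j)^2\<close> is at most
  \<open>j / (t * (t + j)) = 1 / t - 1 / (t + j)\<close>, which is exactly what the second summand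
  of \<open>potential\<close> loses.\<close>

lemma potential_step:
  fixes p j s a z m0 m1 :: real
  assumes mean: "p * m1 + (1 - p) * m0 = 0" and var: "p * m1\<^sup>2 + (1 - p) * m0\<^sup>2 \<le> j"
    and "0 \<le> j" "0 \<le> s" "0 < a"
  shows "p * potential a (z + m1) (s + j) + (1 - p) * potential a (z + m0) (s + j) \<le> potential a z s"
proof -
  define t where "t = s + a"
  have t: "t > 0" "s + j + a = t + j" using assms by (auto simp: t_def)
  have *: "p * (z + m1)\<^sup>2 + (1 - p) * (z + m0)\<^sup>2 = z\<^sup>2 + 2 * z * (p * m1 + (1 - p) * m0) + (p * m1\<^sup>2 + (1 - p) * m0\<^sup>2)"
    by (simp add: power2_eq_square algebra_simps)
  have "p * potential a (z + m1) (s + j) + (1 - p) * potential a (z + m0) (s + j)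
      = (p * (z + m1)\<^sup>2 + (1 - p) * (z + m0)\<^sup>2) / (t + j)\<^sup>2 + 1 / (t + j)"
    unfolding potential_def t(2) power_divide by (simp add: algebra_simps add_divide_distrib diff_divide_distrib)
  also have "\<dots> = (z\<^sup>2 + (p * m1\<^sup>2 + (1 - p) * m0\<^sup>2)) / (t + j)\<^sup>2 + 1 / (t + j)"
    unfolding * mean by simp
  also have "\<dots> \<le> (z\<^sup>2 + j) / (t + j)\<^sup>2 + 1 / (t + j)"
    using var by (intro add_right_mono divide_right_mono) auto
  also have "\<dots> = z\<^sup>2 / (t + j)\<^sup>2 + (j / (t + j)\<^sup>2 + 1 / (t + j))"
    by (simp add: add_divide_distrib)
  also have "\<dots> \<le> z\<^sup>2 / t\<^sup>2 + (j / (t * (t + j)) + 1 / (t + j))"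
    using t \<open>0 \<le> j\<close> by (intro add_mono divide_left_mono power_mono mult_pos_pos)
      (auto simp: power2_eq_square intro!: mult_right_mono)
  also have "j / (t * (t + j)) + 1 / (t + j) = 1 / t"
    using t \<open>0 \<le> j\<close> by (simp add: divide_simps)
  finally show ?thesis
    by (simp add: potential_def t_def power_divide)
qed

context wgraph
begin

lemma pred_reach:
  fixes F :: "'v set set"
  assumes "\<And>e. e \<in> F \<Longrightarrow> Measurable.pred M (\<lambda>x. w x e)"
  shows "Measurable.pred M (\<lambda>x. z \<in> reach F (w x) C)"
proof -
  have "Measurable.pred M (\<lambda>x. (a, b) \<in> {(a, b). {a, b} \<in> F \<and> w x {a, b}})" for a b
    using assms by (cases "{a, b} \<in> F") auto
  then have [measurable]: "Measurable.pred M (\<lambda>x. (c, z) \<in> {(a, b). {a, b} \<in> F \<and> w x {a, b}}\<^sup>*)" for c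
    by (rule pred_rtrancl)
  have "(\<lambda>x. z \<in> reach F (w x) C) = (\<lambda>x. \<exists>c. c \<in> C \<and> (c, z) \<in> {(a, b). {a, b} \<in> F \<and> w x {a, b}}\<^sup>*)"
    by (auto simp: reach_def fun_eq_iff)
  then show ?thesis by simp
qed

lemma pred_touched:
  fixes F :: "'v set set"
  assumes "\<And>e. e \<in> F \<Longrightarrow> Measurable.pred M (\<lambda>x. w x e)"
  shows "Measurable.pred M (\<lambda>x. e \<in> touched F (w x) C)"
proof -
  have [measurable]: "Measurable.pred M (\<lambda>x. v \<in> reach F (w x) C)" for v
    using assms by (rule pred_reach)
  have "(\<lambda>x. e \<in> touched F (w x) C) = (\<lambda>x. e \<in> F \<and> (\<exists>v. v \<in> e \<and> v \<in> reach F (w x) C))"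
    by (auto simp: touched_def fun_eq_iff)
  then show ?thesis by simp
qed

lemma touched_subset: "touched F w C \<subseteq> F"
  by (auto simp: touched_def)

lemma borel_sum_touched:
  fixes m :: "'v set \<Rightarrow> bool \<Rightarrow> real"
  assumes "finite F" "\<And>e. e \<in> F \<Longrightarrow> Measurable.pred M (\<lambda>x. w x e)"
  shows "(\<lambda>x. \<Sum>e\<in>touched F (w x) C. m e (w x e)) \<in> borel_measurable M"
proof -
  have [measurable]: "Measurable.pred M (\<lambda>x. e \<in> touched F (w x) C)" for e
    using assms(2) by (rule pred_touched)
  note [measurable] = assms(2)
  have "(\<lambda>x. \<Sum>e\<in>touched F (w x) C. m e (w x e)) =
     (\<lambda>x. \<Sum>e\<in>F. if e \<in> touched F (w x) C then if w x e then m e True else m e False else 0)"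
  proof
    fix x
    have "(\<Sum>e\<in>touched F (w x) C. m e (w x e)) = (\<Sum>e\<in>F. if e \<in> touched F (w x) C then m e (w x e) else 0)"
      using assms(1) touched_subset[of F "w x" C] by (simp add: sum.inter_restrict[symmetric] Int_absorb1)
    also have "\<dots> = (\<Sum>e\<in>F. if e \<in> touched F (w x) C then if w x e then m e True else m e False else 0)"
      by (intro sum.cong) auto
    finally show "(\<Sum>e\<in>touched F (w x) C. m e (w x e)) = (\<Sum>e\<in>F. if e \<in> touched F (w x) C then if w x e then m e True else m e False else 0)" .
  qed
  then show ?thesis by simp
qed

lemma cluster_eq_reach: "cluster J w v = reach E w {v}"
  by (simp add: cluster_def reach_def open_rel_def edges_def Image_def)

lemma pred_config:
  assumes "e \<in> E" shows "Measurable.pred U (\<lambda>u. u e \<le> p e)"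
  using assms by measurable

text \<open>Revealing one edge at the boundary of the explored cluster either enlarges the seed set
  \<open>C\<close> or deletes that edge, so the exploration martingale reduces to an induction on \<open>F\<close>.\<close>

lemma exploration_bound:
  fixes m :: "'v set \<Rightarrow> bool \<Rightarrow> real"
  assumes "finite F" "F \<subseteq> E" and p: "\<And>e. e \<in> E \<Longrightarrow> 0 \<le> p e \<and> p e \<le> 1"
    and mean: "\<And>e. e \<in> E \<Longrightarrow> p e * m e True + (1 - p e) * m e False = 0"
    and var: "\<And>e. e \<in> E \<Longrightarrow> p e * (m e True)\<^sup>2 + (1 - p e) * (m e False)\<^sup>2 \<le> J e"
    and "a > 0" "s \<ge> 0"
  shows "(\<integral>\<^sup>+u. ennreal (potential a (z + (\<Sum>e\<in>touched F (\<lambda>f. u f \<le> p f) C. m e (u e \<le> p e)))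
                               (s + (\<Sum>e\<in>touched F (\<lambda>f. u f \<le> p f) C. J e))) \<partial>U)
         \<le> ennreal (potential a z s)"
  using assms(1,2) \<open>s \<ge> 0\<close>
proof (induction "card F" arbitrary: F C z s)
  case 0
  interpret prob_space U by (rule prob_space_U)
  from 0 have "F = {}" by auto
  then show ?case by (simp add: touched_def emeasure_space_1)
next
  case (Suc n)
  interpret prob_space U by (rule prob_space_U)
  show ?case
  proof (cases "\<exists>e\<in>F. e \<inter> C \<noteq> {}")
    \<comment> \<open>No unrevealed edge meets the seeds: the exploration has stopped, both sums are
      empty and the integrand is the initial potential.\<close>
    case False
    then have "touched F w C = {}" for w
      by (intro touched_empty) auto
    then show ?thesis by (simp add: emeasure_space_1)
  next
    case True
    then obtain e where e: "e \<in> F" "e \<inter> C \<noteq> {}" by auto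
    then have eE: "e \<in> E" using Suc.prems by auto
    then obtain x y where xy: "e = {x, y}" by (auto simp: edges_def elim: edgeE)
    define F' where "F' = F - {e}"
    have F': "card F' = n" "finite F'" "F' \<subseteq> E" "e \<notin> F'"
      using Suc.hyps(2) Suc.prems e by (auto simp: F'_def)
    define \<Psi> where "\<Psi> F C z s w = ennreal (potential a (z + (\<Sum>e\<in>touched F w C. m e (w e)))
                               (s + (\<Sum>e\<in>touched F w C. J e)))" for F C z s w
    have meas: "(\<lambda>u. \<Psi> F C z s (\<lambda>f. u f \<le> p f)) \<in> borel_measurable U" if "finite F" "F \<subseteq> E" for F C z s
    proof -
      have [measurable]: "(\<lambda>u. \<Sum>e\<in>touched F (\<lambda>f. u f \<le> p f) C. k e (u e \<le> p e)) \<in> borel_measurable U"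
        for k :: "'v set \<Rightarrow> bool \<Rightarrow> real"
        using that by (intro borel_sum_touched pred_config) auto
      have [measurable]: "(\<lambda>u. \<Sum>e\<in>touched F (\<lambda>f. u f \<le> p f) C. J e) \<in> borel_measurable U"
        using that by (intro borel_sum_touched pred_config) auto
      show ?thesis
        unfolding \<Psi>_def potential_def by measurable
    qed
    have fin: "finite (touched F' w C)" for w C
      using finite_subset[OF touched_subset F'(2)] .
    have notin: "e \<notin> touched F' w C" for w C
      using touched_subset F'(4) by auto
    have sum_upd: "(\<Sum>f\<in>touched F' w C. m f ((w(e := b)) f)) = (\<Sum>f\<in>touched F' w C. m f (w f))" for w C b
      using notin by (intro sum.cong) auto
    have "touched F (w(e := True)) C = insert e (touched F' w (C \<union> e))" for w
      using touched_open[of e F "w(e := True)" x y C] e xy touched_upd[OF F'(4)] by (simp add: F'_def)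
    then have open_e: "\<Psi> F C z s (w(e := True)) = \<Psi> F' (C \<union> e) (z + m e True) (s + J e) w" for w
      unfolding \<Psi>_def using notin fin sum_upd[of w True] by (simp add: add.assoc del: fun_upd_apply) simp
    have "touched F (w(e := False)) C = insert e (touched F' w C)" for w
      using touched_closed[of e F "w(e := False)" C] e touched_upd[OF F'(4)] by (simp add: F'_def)
    then have closed_e: "\<Psi> F C z s (w(e := False)) = \<Psi> F' C (z + m e False) (s + J e) w" for w
      unfolding \<Psi>_def using notin fin sum_upd[of w False] by (simp add: add.assoc del: fun_upd_apply) simp
    have "(\<integral>\<^sup>+u. \<Psi> F C z s (\<lambda>f. u f \<le> p f) \<partial>U) =
        (\<integral>\<^sup>+u. ennreal (p e) * \<Psi> F' (C \<union> e) (z + m e True) (s + J e) (\<lambda>f. u f \<le> p f)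
          + ennreal (1 - p e) * \<Psi> F' C (z + m e False) (s + J e) (\<lambda>f. u f \<le> p f) \<partial>U)"
      using p[OF eE] meas[OF Suc.prems(1,2)]
      by (subst nn_integral_resample[OF eE]) (simp_all add: open_e closed_e)
    also have "\<dots> = ennreal (p e) * (\<integral>\<^sup>+u. \<Psi> F' (C \<union> e) (z + m e True) (s + J e) (\<lambda>f. u f \<le> p f) \<partial>U)
          + ennreal (1 - p e) * (\<integral>\<^sup>+u. \<Psi> F' C (z + m e False) (s + J e) (\<lambda>f. u f \<le> p f) \<partial>U)"
      using meas[OF F'(2,3)] by (simp add: nn_integral_add nn_integral_cmult)
    also have "\<dots> \<le> ennreal (p e) * ennreal (potential a (z + m e True) (s + J e))
          + ennreal (1 - p e) * ennreal (potential a (z + m e False) (s + J e))"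
      unfolding \<Psi>_def using F' Suc.prems(3) J_nonneg[of e]
      by (intro add_mono mult_left_mono Suc.hyps(1)) auto
    also have "\<dots> = ennreal (p e * potential a (z + m e True) (s + J e) + (1 - p e) * potential a (z + m e False) (s + J e))"
      using p[OF eE] Suc.prems(3) J_nonneg[of e] \<open>a > 0\<close>
      by (simp add: ennreal_mult ennreal_plus potential_nonneg)
    also have "\<dots> \<le> ennreal (potential a z s)"
      using mean[OF eE] var[OF eE] Suc.prems(3) J_nonneg[of e] \<open>a > 0\<close>
      by (intro ennreal_leI potential_step)
    finally show ?thesis by (simp add: \<Psi>_def)
  qed
qed

end

section \<open>Exhausting the graph by finite edge sets\<close>

lemma in_reach_Union:
  assumes "incseq F" "z \<in> reach (\<Union>n. F n) w C"
  shows "\<exists>n. z \<in> reach (F n) w C"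
proof -
  have mono: "reach (F m) w C \<subseteq> reach (F n) w C" if "m \<le> n" for m n
    using incseqD[OF assms(1) that] subset_reach[of C "F n" w]
    by (intro reach_least) (auto intro: reach_step)
  have "reach (\<Union>n. F n) w C \<subseteq> (\<Union>n. reach (F n) w C)"
  proof (rule reach_least)
    show "C \<subseteq> (\<Union>n. reach (F n) w C)" using subset_reach[of C] by auto
    fix a b assume *: "a \<in> (\<Union>n. reach (F n) w C)" "{a, b} \<in> (\<Union>n. F n)" "w {a, b}"
    then obtain m n where mn: "a \<in> reach (F m) w C" "{a, b} \<in> F n" by auto
    have "a \<in> reach (F (max m n)) w C" "{a, b} \<in> F (max m n)"
      using mono[of m "max m n"] incseqD[OF assms(1), of n "max m n"] mn by auto
    then show "b \<in> (\<Union>n. reach (F n) w C)"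
      using * by (auto intro: reach_step)
  qed
  then show ?thesis using assms(2) by auto
qed

lemma reach_mono: "F \<subseteq> G \<Longrightarrow> reach F w C \<subseteq> reach G w C"
  using subset_reach[of C G w] by (intro reach_least) (auto intro: reach_step)

text \<open>Each vertex is reached from some index on, since a path uses finitely many edges.
  Finiteness of the limit set makes this index uniform.\<close>

lemma eventually_reach_eq:
  assumes "incseq F" "finite (reach (\<Union>n. F n) w C)"
  shows "\<forall>\<^sub>F n in sequentially. reach (F n) w C = reach (\<Union>n. F n) w C"
proof -
  have "\<forall>\<^sub>F n in sequentially. z \<in> reach (F n) w C" if z: "z \<in> reach (\<Union>n. F n) w C" for z
  proof -
    obtain m where "z \<in> reach (F m) w C" using in_reach_Union[OF assms(1) z] by auto
    then show ?thesis
      using reach_mono[OF incseqD[OF assms(1)]] by (intro eventually_sequentiallyI[of m]) blast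
  qed
  then have "\<forall>\<^sub>F n in sequentially. \<forall>z\<in>reach (\<Union>n. F n) w C. z \<in> reach (F n) w C"
    using assms(2) by (simp add: eventually_ball_finite)
  then show ?thesis
  proof eventually_elim
    case (elim n)
    then show ?case using reach_mono[of "F n" "\<Union>n. F n" w C] by auto
  qed
qed

text \<open>At \<open>t = 1\<close> resp. \<open>t = 0\<close> division by zero gives the value \<open>0\<close>, which is what the convention of
  the theorem and the balance \<open>t * alpha j t = (1 - t) * beta j t\<close> require.\<close>

definition beta :: "real \<Rightarrow> real \<Rightarrow> real" where
  "beta j t = sqrt (j * t / (1 - t))"

definition alpha :: "real \<Rightarrow> real \<Rightarrow> real" where
  "alpha j t = sqrt (j * (1 - t) / t)"

text \<open>The first two equations give the mean-zero condition, the third the variance. The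
  variance equals \<open>j\<close> for \<open>0 < t < 1\<close>; at the endpoints the division
  default makes it 0, whence the inequality.\<close>

lemma alpha_beta:
  assumes "0 \<le> t" "t \<le> 1" "0 \<le> j"
  shows "t * alpha j t = sqrt (j * t * (1 - t))" "(1 - t) * beta j t = sqrt (j * t * (1 - t))"
    "t * (alpha j t)\<^sup>2 + (1 - t) * (beta j t)\<^sup>2 \<le> j"
    "0 \<le> alpha j t" "0 \<le> beta j t"
proof -
  show "0 \<le> alpha j t" "0 \<le> beta j t" using assms by (auto simp: alpha_def beta_def)
  have "t = sqrt (t * t)" "1 - t = sqrt ((1 - t) * (1 - t))" using assms by auto
  then have "t * alpha j t = sqrt ((t * t) * (j * (1 - t) / t))"
    "(1 - t) * beta j t = sqrt (((1 - t) * (1 - t)) * (j * t / (1 - t)))"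
    unfolding alpha_def beta_def by (metis real_sqrt_mult)+
  moreover have "(t * t) * (j * (1 - t) / t) = j * t * (1 - t)"
    "((1 - t) * (1 - t)) * (j * t / (1 - t)) = j * t * (1 - t)" by auto
  ultimately show "t * alpha j t = sqrt (j * t * (1 - t))" "(1 - t) * beta j t = sqrt (j * t * (1 - t))"
    by simp_all
  have "t * (alpha j t)\<^sup>2 \<le> j * (1 - t)"
    using assms by (cases "t = 0") (auto simp: alpha_def)
  moreover have "(1 - t) * (beta j t)\<^sup>2 \<le> j * t"
    using assms by (cases "t = 1") (auto simp: beta_def)
  ultimately show "t * (alpha j t)\<^sup>2 + (1 - t) * (beta j t)\<^sup>2 \<le> j"
    by (simp add: algebra_simps)
qed

section \<open>Graphs of constant weighted degree\<close>

locale regular_wgraph = wgraph J for J :: "'v::countable set \<Rightarrow> real" +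
  fixes d :: real
  assumes degree: "\<And>v. (\<Sum>\<^sub>\<infinity>y. J {v, y}) = d"
begin

lemma d_nonneg: "d \<ge> 0"
  using degree[of undefined] infsum_nonneg[of UNIV "\<lambda>y. J {undefined, y}"] J_nonneg by auto

lemma nn_integral_degree: "(\<integral>\<^sup>+y. ennreal (J {v, y}) \<partial>count_space UNIV) = ennreal d"
proof -
  have "Infinite_Set_Sum.abs_summable_on (\<lambda>y. J {v, y}) UNIV"
    using J_summable[of v] by (subst abs_summable_equivalent[symmetric], subst summable_on_iff_abs_summable_on_real[symmetric])
  then show ?thesis
    using J_nonneg by (simp add: nn_integral_conv_infsetsum infsetsum_infsum degree)
qed

lemma sum_edges_at_le:
  assumes "finite T" "T \<subseteq> E" "\<And>e. e \<in> T \<Longrightarrow> x \<in> e"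
  shows "sum J T \<le> d"
proof -
  define Y where "Y = {y. {x, y} \<in> T}"
  have inj: "inj_on (\<lambda>y. {x, y}) Y" by (auto simp: inj_on_def doubleton_eq_iff)
  have T: "T = (\<lambda>y. {x, y}) ` Y"
  proof
    show "T \<subseteq> (\<lambda>y. {x, y}) ` Y"
    proof
      fix e assume e: "e \<in> T"
      then obtain a b where "e = {a, b}" using assms(2) by (auto simp: edges_def elim!: edgeE)
      then have "\<exists>y. e = {x, y}" using assms(3)[OF e] by auto
      then show "e \<in> (\<lambda>y. {x, y}) ` Y" using e by (auto simp: Y_def)
    qed
  qed (auto simp: Y_def)
  have "finite Y" using assms(1) finite_imageD[OF _ inj] T by auto
  have "sum J T = (\<Sum>y\<in>Y. J {x, y})"
    using inj by (subst T) (simp add: sum.reindex)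
  also have "\<dots> \<le> (\<Sum>\<^sub>\<infinity>y. J {x, y})"
    using \<open>finite Y\<close> J_summable J_nonneg by (intro finite_sum_le_infsum) auto
  finally show ?thesis by (simp add: degree)
qed

lemma sum_touching_le:
  assumes "finite T" "T \<subseteq> E" "finite K" "\<And>e. e \<in> T \<Longrightarrow> e \<inter> K \<noteq> {}"
  shows "sum J T \<le> d * card K"
proof -
  have "sum J T \<le> (\<Sum>e\<in>T. \<Sum>x\<in>K. if x \<in> e then J e else 0)"
  proof (rule sum_mono)
    fix e assume "e \<in> T"
    then obtain x where "x \<in> e" "x \<in> K" using assms(4) by blast
    then show "J e \<le> (\<Sum>x\<in>K. if x \<in> e then J e else 0)"
      using member_le_sum[of x K "\<lambda>x. if x \<in> e then J e else 0"] assms(3) J_nonneg by auto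
  qed
  also have "\<dots> = (\<Sum>x\<in>K. sum J {e\<in>T. x \<in> e})"
    using assms(1) by (subst sum.swap) (auto simp: sum.inter_filter intro!: sum.cong)
  also have "\<dots> \<le> (\<Sum>x\<in>K. d)"
    using assms by (intro sum_mono sum_edges_at_le) auto
  finally show ?thesis by (simp add: mult.commute)
qed

definition long_edges :: "real \<Rightarrow> 'v set \<Rightarrow> 'v set set" where
  "long_edges \<epsilon> K = {e \<in> E. e \<inter> K \<noteq> {} \<and> \<epsilon> \<le> J e}"

text \<open>Every long edge uses up at least \<open>\<epsilon>\<close> of a total weight of at most
  \<open>d * card K\<close>. Local finiteness is not assumed, so without the cut-off even one vertex
  may be touched by infinitely many edges.\<close>

lemma finite_long_edges:
  assumes "finite K" "\<epsilon> > 0"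
  shows "finite (long_edges \<epsilon> K)"
proof (rule finite_if_finite_subsets_card_bdd[of _ "nat \<lceil>d * card K / \<epsilon>\<rceil>", THEN conjunct1])
  fix T assume T: "T \<subseteq> long_edges \<epsilon> K" "finite T"
  then have "\<epsilon> * card T \<le> sum J T"
    using sum_mono[of T "\<lambda>_. \<epsilon>" J] by (auto simp: long_edges_def mult.commute)
  also have "\<dots> \<le> d * card K"
    using T assms by (intro sum_touching_le) (auto simp: long_edges_def)
  finally have "card T \<le> d * card K / \<epsilon>"
    using assms by (simp add: field_simps)
  then show "card T \<le> nat \<lceil>d * card K / \<epsilon>\<rceil>" by linarith
qed

definition increment :: "real \<Rightarrow> ('v set \<Rightarrow> real) \<Rightarrow> 'v set \<Rightarrow> bool \<Rightarrow> real" where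
  "increment \<epsilon> p e b = (if \<epsilon> \<le> J e then if b then - alpha (J e) (p e) else beta (J e) (p e) else 0)"

definition fluctuation :: "real \<Rightarrow> ('v set \<Rightarrow> real) \<Rightarrow> ('v set \<Rightarrow> bool) \<Rightarrow> 'v \<Rightarrow> real" where
  "fluctuation \<epsilon> p w v = (\<Sum>e\<in>long_edges \<epsilon> (cluster J w v). increment \<epsilon> p e (w e))"

text \<open>\<open>exploration_bound\<close> speaks of finite edge sets only. Along an exhaustion of
  \<open>E\<close> the explored quantities of a finite cluster eventually dominate the integrand,
  and Fatou's lemma carries the uniform bound to the limit.\<close>

lemma nn_integral_fluctuation_le:
  assumes p: "\<And>e. e \<in> E \<Longrightarrow> 0 \<le> p e \<and> p e \<le> 1" and "\<epsilon> > 0" "a > 0" "c \<ge> 0"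
  shows "(\<integral>\<^sup>+u. (let w = \<lambda>e. u e \<le> p e in
            if finite (cluster J w v) then ennreal (c * \<bar>fluctuation \<epsilon> p w v\<bar> / (d * card (cluster J w v) + a)) else 0) \<partial>U)
         \<le> ennreal (c / sqrt a)"
proof -
  interpret prob_space U by (rule prob_space_U)
  define F where "F n = from_nat_into E ` {..n} \<inter> E" for n
  have F: "finite (F n)" "F n \<subseteq> E" for n by (auto simp: F_def)
  have incF: "incseq F" by (fastforce simp: F_def incseq_def)
  have UF: "(\<Union>n. F n) = E"
  proof
    show "E \<subseteq> (\<Union>n. F n)"
      using countable_edges by (auto simp: F_def) (metis from_nat_into_surj atMost_iff imageI order_refl)
  qed (auto simp: F_def)
  define m where "m = increment \<epsilon> p"
  define Z where "Z n w = (\<Sum>e\<in>touched (F n) w {v}. m e (w e))" for n and w :: "'v set \<Rightarrow> bool"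
  define S where "S n w = (\<Sum>e\<in>touched (F n) w {v}. J e)" for n and w :: "'v set \<Rightarrow> bool"
  \<comment> \<open>Twice the square root of a product is at most a sum: this converts the
    second-moment bound into one for the absolute value. As \<open>potential a 0 0 = 1 / a\<close>,
    each summand contributes at most \<open>c / (2 * sqrt a)\<close> to the integral.\<close>
  define \<Psi> where "\<Psi> n w = ennreal (c * sqrt a / 2) * ennreal (potential a (0 + Z n w) (0 + S n w)) + ennreal (c / (2 * sqrt a))" for n w
  have meas[measurable]: "(\<lambda>u. Z n (\<lambda>f. u f \<le> p f)) \<in> borel_measurable U" "(\<lambda>u. S n (\<lambda>f. u f \<le> p f)) \<in> borel_measurable U" for n
    unfolding Z_def S_def using F[of n] by (intro borel_sum_touched pred_config; auto)+
  have int: "(\<integral>\<^sup>+u. \<Psi> n (\<lambda>f. u f \<le> p f) \<partial>U) \<le> ennreal (c / sqrt a)" for n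
  proof -
    have "(\<integral>\<^sup>+u. \<Psi> n (\<lambda>f. u f \<le> p f) \<partial>U)
      = ennreal (c * sqrt a / 2) * (\<integral>\<^sup>+u. ennreal (potential a (0 + Z n (\<lambda>f. u f \<le> p f)) (0 + S n (\<lambda>f. u f \<le> p f))) \<partial>U) + ennreal (c / (2 * sqrt a))"
      unfolding \<Psi>_def potential_def by (subst nn_integral_add) (auto simp: nn_integral_cmult emeasure_space_1)
    also have "\<dots> \<le> ennreal (c * sqrt a / 2) * ennreal (potential a 0 0) + ennreal (c / (2 * sqrt a))"
      unfolding Z_def S_def
      by (intro add_right_mono mult_left_mono exploration_bound)
        (use F p \<open>a > 0\<close> alpha_beta J_nonneg in \<open>auto simp: m_def increment_def\<close>)
    also have "\<dots> = ennreal (c * sqrt a / 2 * (1 / a) + c / (2 * sqrt a))"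
      unfolding potential_def using \<open>a > 0\<close> \<open>c \<ge> 0\<close>
      by (subst ennreal_plus) (auto simp flip: ennreal_mult)
    also have "c * sqrt a / 2 * (1 / a) + c / (2 * sqrt a) = c / sqrt a"
      using \<open>a > 0\<close> by (simp add: field_simps)
    finally show ?thesis .
  qed
  have pointwise: "(if finite (cluster J w v) then ennreal (c * \<bar>fluctuation \<epsilon> p w v\<bar> / (d * card (cluster J w v) + a)) else 0)
      \<le> liminf (\<lambda>n. \<Psi> n w)" for w
  proof (cases "finite (cluster J w v)")
    case True
    define K where "K = cluster J w v"
    have fin: "finite (long_edges \<epsilon> K)" using True \<open>\<epsilon> > 0\<close> by (auto simp: K_def finite_long_edges)
    have "\<forall>\<^sub>F n in sequentially. reach (F n) w {v} = K"
      using eventually_reach_eq[OF incF, of w "{v}"] True by (simp add: UF K_def cluster_eq_reach)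
    \<comment> \<open>Again a uniform index, available because the long edges are finite in
      number.\<close>
    moreover have "\<forall>\<^sub>F n in sequentially. \<forall>e\<in>long_edges \<epsilon> K. e \<in> F n"
    proof (subst eventually_ball_finite_distrib[OF fin], rule ballI)
      fix e assume "e \<in> long_edges \<epsilon> K"
      then obtain k where "e \<in> F k" using UF by (auto simp: long_edges_def)
      then show "\<forall>\<^sub>F n in sequentially. e \<in> F n"
        using incseqD[OF incF] by (intro eventually_sequentiallyI[of k]) auto
    qed
    ultimately have "\<forall>\<^sub>F n in sequentially. ennreal (c * \<bar>fluctuation \<epsilon> p w v\<bar> / (d * card K + a)) \<le> \<Psi> n w"
    proof eventually_elim
      case (elim n)
      have sub: "long_edges \<epsilon> K \<subseteq> touched (F n) w {v}"
        using elim by (auto simp: touched_def long_edges_def)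
      have finT: "finite (touched (F n) w {v})"
        using F touched_subset finite_subset by metis
      \<comment> \<open>The touched edges in \<open>F n\<close> may include short ones, but their
        increments vanish.\<close>
      have Z: "Z n w = fluctuation \<epsilon> p w v"
        unfolding Z_def fluctuation_def m_def K_def[symmetric]
      proof (rule sum.mono_neutral_right[OF finT sub], rule ballI)
        fix e assume "e \<in> touched (F n) w {v} - long_edges \<epsilon> K"
        then have "\<not> \<epsilon> \<le> J e" using elim(1) F(2)[of n] by (auto simp: touched_def long_edges_def)
        then show "increment \<epsilon> p e (w e) = 0" by (simp add: increment_def)
      qed
      \<comment> \<open>The random touched weight is replaced by \<open>d * card K\<close>, so that
        the final denominator depends on the size of the cluster only and can be matched with the
        probability of being green.\<close>
      have S: "S n w \<le> d * card K" "0 \<le> S n w"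
        unfolding S_def using F(2)[of n] elim(1) finT True J_nonneg
        by (auto intro!: sum_touching_le sum_nonneg simp: touched_def K_def)
      define q where "q = \<bar>Z n w\<bar> / (S n w + a)"
      have q0: "0 \<le> q" using S \<open>a > 0\<close> by (simp add: q_def)
      have "c * \<bar>fluctuation \<epsilon> p w v\<bar> / (d * card K + a) \<le> c * \<bar>Z n w\<bar> / (S n w + a)"
        unfolding Z using S \<open>a > 0\<close> \<open>c \<ge> 0\<close> by (intro divide_left_mono mult_pos_pos) auto
      also have "\<dots> = c * q" by (simp add: q_def)
      also have "q \<le> (sqrt a * q\<^sup>2 + 1 / sqrt a) / 2"
      proof -
        define r where "r = sqrt a"
        have "r > 0" using \<open>a > 0\<close> by (simp add: r_def)
        have "0 \<le> (r * q - 1)\<^sup>2 / r" using \<open>r > 0\<close> by simp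
        also have "(r * q - 1)\<^sup>2 / r = r * q\<^sup>2 - 2 * q + 1 / r"
          using \<open>r > 0\<close> by (simp add: power2_eq_square field_simps)
        finally show ?thesis by (simp add: r_def)
      qed
      also have "\<dots> \<le> (sqrt a * potential a (Z n w) (S n w) + 1 / sqrt a) / 2"
        using S \<open>a > 0\<close> by (intro divide_right_mono add_right_mono mult_left_mono)
          (auto simp: potential_def q_def power_divide)
      finally have le: "c * \<bar>fluctuation \<epsilon> p w v\<bar> / (d * card K + a) \<le> c * ((sqrt a * potential a (Z n w) (S n w) + 1 / sqrt a) / 2)"
        using \<open>c \<ge> 0\<close> by (simp add: mult_left_mono)
      have "\<Psi> n w = ennreal (c * sqrt a / 2 * potential a (Z n w) (S n w) + c / (2 * sqrt a))"
        using potential_nonneg[OF S(2) \<open>a > 0\<close>] \<open>a > 0\<close> \<open>c \<ge> 0\<close>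
        unfolding \<Psi>_def by (subst ennreal_plus) (auto simp flip: ennreal_mult)
      also have "c * sqrt a / 2 * potential a (Z n w) (S n w) + c / (2 * sqrt a) = c * ((sqrt a * potential a (Z n w) (S n w) + 1 / sqrt a) / 2)"
        by (simp add: algebra_simps add_divide_distrib)
      finally show ?case using le by (simp add: ennreal_leI)
    qed
    then show ?thesis using True by (auto simp: K_def intro: Liminf_bounded)
  qed simp
  have "(\<integral>\<^sup>+u. (let w = \<lambda>e. u e \<le> p e in
            if finite (cluster J w v) then ennreal (c * \<bar>fluctuation \<epsilon> p w v\<bar> / (d * card (cluster J w v) + a)) else 0) \<partial>U)
      \<le> (\<integral>\<^sup>+u. liminf (\<lambda>n. \<Psi> n (\<lambda>f. u f \<le> p f)) \<partial>U)"
    unfolding Let_def by (intro nn_integral_mono pointwise)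
  also have "\<dots> \<le> liminf (\<lambda>n. \<integral>\<^sup>+u. \<Psi> n (\<lambda>f. u f \<le> p f) \<partial>U)"
    by (intro nn_integral_liminf) (simp add: \<Psi>_def potential_def)
  also have "\<dots> \<le> ennreal (c / sqrt a)"
    using int by (intro order_trans[OF Liminf_le_Limsup Limsup_bounded]) auto
  finally show ?thesis .
qed

end

section \<open>Mass transport\<close>

lemma borel_nn_integral_countable:
  fixes f :: "'a \<Rightarrow> 'v::countable \<Rightarrow> ennreal"
  assumes "\<And>v. (\<lambda>x. f x v) \<in> borel_measurable M"
  shows "(\<lambda>x. \<integral>\<^sup>+v. f x v \<partial>count_space UNIV) \<in> borel_measurable M"
proof -
  interpret sigma_finite_measure "count_space (UNIV :: 'v set)"
    by (rule sigma_finite_measure_count_space_countable) auto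
  have "(\<lambda>z. f (fst z) (snd z)) \<in> borel_measurable (M \<Otimes>\<^sub>M count_space UNIV)"
    by (rule measurable_compose_countable[where g = snd, OF measurable_compose[OF measurable_fst assms]]) simp
  then have "case_prod f \<in> borel_measurable (M \<Otimes>\<^sub>M count_space UNIV)"
    by (simp add: case_prod_beta')
  then show ?thesis by (rule borel_measurable_nn_integral)
qed

lemma ennreal_inverse_of_nat: "n \<noteq> 0 \<Longrightarrow> inverse (of_nat n) * of_nat n = (1 :: ennreal)"
  using ennreal_divide_self[of "of_nat n"] by (simp add: divide_ennreal_def mult.commute of_nat_less_top)

text \<open>Fix \<open>z\<close>. The relation \<open>R v u\<close> says that a group element moves
  the pair \<open>(z, v)\<close> to \<open>(u, z)\<close>, and then \<open>F z v = F u z\<close>.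
  The mass \<open>F z v\<close> is split evenly among the \<open>c v\<close> vertices
  \<open>u\<close> related to \<open>v\<close>. Since \<open>R\<close> is symmetric and
  \<open>c\<close> is constant along it, regrouping by \<open>u\<close> gathers exactly
  \<open>F u z\<close>. Counting orbits in this way avoids Haar measure.\<close>

lemma mass_transport:
  fixes \<Gamma> :: "('v::countable \<Rightarrow> 'v) set" and F :: "'v \<Rightarrow> 'v \<Rightarrow> ennreal"
  assumes bij: "\<And>a. a \<in> \<Gamma> \<Longrightarrow> bij a" and id: "id \<in> \<Gamma>"
    and comp: "\<And>a b. a \<in> \<Gamma> \<Longrightarrow> b \<in> \<Gamma> \<Longrightarrow> a \<circ> b \<in> \<Gamma>" and inv: "\<And>a. a \<in> \<Gamma> \<Longrightarrow> inv a \<in> \<Gamma>"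
    and trans: "transitive_group \<Gamma>" and unimod: "unimodular \<Gamma>"
    and fin: "\<And>x y. finite (stab_orbit \<Gamma> x y)"
    and F: "\<And>a u v. a \<in> \<Gamma> \<Longrightarrow> F (a u) (a v) = F u v"
  shows "(\<integral>\<^sup>+v. F z v \<partial>count_space UNIV) = (\<integral>\<^sup>+u. F u z \<partial>count_space UNIV)"
proof -
  define R where "R v u \<longleftrightarrow> (\<exists>a\<in>\<Gamma>. a z = u \<and> a v = z)" for v u
  define c where "c v = card (stab_orbit \<Gamma> v z)" for v
  have invs: "a (inv a x) = x" "inv a (a x) = x" if "a \<in> \<Gamma>" for a x
    using bij[OF that] by (auto simp: bij_def surj_f_inv_f)
  have symR: "R v u \<longleftrightarrow> R u v" for u v
    unfolding R_def by (metis inv invs)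
  have c0: "c v \<noteq> 0" for v
  proof -
    have "z \<in> stab_orbit \<Gamma> v z" unfolding stab_orbit_def using id by (auto intro!: exI[of _ id])
    then show ?thesis using fin[of v z] by (auto simp: c_def)
  qed
  have orbit_image: "a ` stab_orbit \<Gamma> x y = stab_orbit \<Gamma> (a x) (a y)" if a: "a \<in> \<Gamma>" for a x y
  proof (intro equalityI subsetI)
    fix t assume "t \<in> a ` stab_orbit \<Gamma> x y"
    then obtain b where "b \<in> \<Gamma>" "b x = x" "t = a (b y)" by (auto simp: stab_orbit_def)
    then show "t \<in> stab_orbit \<Gamma> (a x) (a y)"
      unfolding stab_orbit_def using a by (auto simp: invs intro!: exI[of _ "a \<circ> b \<circ> inv a"] comp inv)
  next
    fix t assume "t \<in> stab_orbit \<Gamma> (a x) (a y)"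
    then obtain b where b: "b \<in> \<Gamma>" "b (a x) = a x" "t = b (a y)" by (auto simp: stab_orbit_def)
    then have "inv a t \<in> stab_orbit \<Gamma> x y"
      unfolding stab_orbit_def using a by (auto simp: invs intro!: exI[of _ "inv a \<circ> b \<circ> a"] comp inv)
    then show "t \<in> a ` stab_orbit \<Gamma> x y" using invs(1)[OF a, of t] by (metis imageI)
  qed
  \<comment> \<open>If \<open>a\<close> sends \<open>v\<close> to \<open>z\<close>, the elements
    sending \<open>v\<close> to \<open>z\<close> form the coset of \<open>a\<close> by the
    stabiliser of \<open>v\<close>; so the related vertices are the image under \<open>a\<close> of
    the stabiliser orbit of \<open>z\<close>.\<close>
  have card_R: "card {u. R v u} = c v" "finite {u. R v u}" for v
  proof -
    obtain a where a: "a \<in> \<Gamma>" "a v = z" using trans by (auto simp: transitive_group_def)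
    have "{u. R v u} = a ` stab_orbit \<Gamma> v z"
    proof (intro equalityI subsetI)
      fix u assume "u \<in> {u. R v u}"
      then obtain b where b: "b \<in> \<Gamma>" "b z = u" "b v = z" by (auto simp: R_def)
      then have "inv a u \<in> stab_orbit \<Gamma> v z"
        unfolding stab_orbit_def using a invs(2)[OF a(1), of v]
        by (auto intro!: exI[of _ "inv a \<circ> b"] comp inv)
      then show "u \<in> a ` stab_orbit \<Gamma> v z" using invs(1)[OF a(1), of u] by (metis imageI)
    next
      fix u assume "u \<in> a ` stab_orbit \<Gamma> v z"
      then obtain b where "b \<in> \<Gamma>" "b v = v" "u = a (b z)" by (auto simp: stab_orbit_def)
      then show "u \<in> {u. R v u}" using a by (auto simp: R_def intro!: bexI[of _ "a \<circ> b"] comp)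
    qed
    moreover have "inj a" using bij[OF a(1)] by (simp add: bij_def)
    ultimately show "card {u. R v u} = c v" "finite {u. R v u}"
      using fin by (auto simp: c_def card_image inj_on_subset)
  qed
  \<comment> \<open>Unimodularity enters here: moving by \<open>a\<close> turns the orbit of
    \<open>z\<close> under the stabiliser of \<open>v\<close> into the orbit of \<open>u\<close>
    under the stabiliser of \<open>z\<close>, and exchanging the two roles preserves its
    size.\<close>
  have c_eq: "c v = c u" if "R v u" for u v
  proof -
    obtain a where a: "a \<in> \<Gamma>" "a z = u" "a v = z" using \<open>R v u\<close> by (auto simp: R_def)
    have "c v = card (a ` stab_orbit \<Gamma> v z)"
      using bij[OF a(1)] by (metis c_def card_image bij_def inj_on_subset subset_UNIV)
    also have "\<dots> = card (stab_orbit \<Gamma> z u)" using orbit_image[OF a(1)] a by simp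
    also have "\<dots> = c u" using unimod by (simp add: unimodular_def c_def)
    finally show ?thesis .
  qed
  have sum_R: "(\<integral>\<^sup>+u. inverse (of_nat (c v)) * indicator {u. R v u} u \<partial>count_space UNIV) = (1::ennreal)" for v
    using card_R[of v] c0[of v]
    by (subst nn_integral_cmult_indicator) (auto simp: ennreal_inverse_of_nat)
  have FR: "F z v = F u z" if "R v u" for u v
    using that F by (auto simp: R_def)
  have "(\<integral>\<^sup>+v. F z v \<partial>count_space UNIV)
      = (\<integral>\<^sup>+v. F z v * (\<integral>\<^sup>+u. inverse (of_nat (c v)) * indicator {u. R v u} u \<partial>count_space UNIV) \<partial>count_space UNIV)"
    by (simp add: sum_R)
  also have "\<dots> = (\<integral>\<^sup>+v. \<integral>\<^sup>+u. F z v * (inverse (of_nat (c v)) * indicator {u. R v u} u) \<partial>count_space UNIV \<partial>count_space UNIV)"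
    by (simp add: nn_integral_cmult)
  also have "\<dots> = (\<integral>\<^sup>+u. \<integral>\<^sup>+v. F z v * (inverse (of_nat (c v)) * indicator {u. R v u} u) \<partial>count_space UNIV \<partial>count_space UNIV)"
    by (intro nn_integral_count_space_nn_integral) auto
  also have "\<dots> = (\<integral>\<^sup>+u. \<integral>\<^sup>+v. F u z * (inverse (of_nat (c u)) * indicator {v. R u v} v) \<partial>count_space UNIV \<partial>count_space UNIV)"
  proof (intro nn_integral_cong)
    fix u v
    show "F z v * (inverse (of_nat (c v)) * indicator {u. R v u} u) = F u z * (inverse (of_nat (c u)) * indicator {v. R u v} v)"
      using FR[of v u] c_eq[of v u] symR[of v u] by (cases "R v u") auto
  qed
  also have "\<dots> = (\<integral>\<^sup>+u. F u z * (\<integral>\<^sup>+v. inverse (of_nat (c u)) * indicator {v. R u v} v \<partial>count_space UNIV) \<partial>count_space UNIV)"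
    by (simp add: nn_integral_cmult)
  also have "\<dots> = (\<integral>\<^sup>+u. F u z \<partial>count_space UNIV)"
    by (simp add: sum_R)
  finally show ?thesis .
qed

text \<open>Quantifying over pairs of vertices instead of sets keeps the existential countable, as
  measurability requires.\<close>

lemma touches_green_iff:
  assumes "weighted_graph J"
  shows "touches_green J g K \<longleftrightarrow> (\<exists>x y. x \<in> K \<and> J {x, y} > 0 \<and> g {x, y})"
proof
  assume "touches_green J g K"
  then obtain f x where f: "J f > 0" "g f" "x \<in> f" "x \<in> K" by (auto simp: touches_green_def)
  then obtain a b where "f = {a, b}" using assms by (auto simp: weighted_graph_def) (metis less_irrefl)
  then have "f = {x, b} \<or> f = {x, a}" using f by auto
  then show "\<exists>x y. x \<in> K \<and> J {x, y} > 0 \<and> g {x, y}" using f by auto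
qed (auto simp: touches_green_def)

lemma touches_green_Un: "touches_green J g (A \<union> B) \<longleftrightarrow> touches_green J g A \<or> touches_green J g B"
  by (auto simp: touches_green_def)

lemma reach_Un: "reach F w (A \<union> B) = reach F w A \<union> reach F w B"
  by (auto simp: reach_def)

section \<open>Live clusters and the mass they receive\<close>

context wgraph
begin

lemma cluster_refl: "v \<in> cluster J w v"
  by (simp add: cluster_def)

lemma cluster_sym: "u \<in> cluster J w v \<longleftrightarrow> v \<in> cluster J w u"
proof -
  have "sym (open_rel J w)" by (auto simp: sym_def open_rel_def insert_commute)
  then show ?thesis unfolding cluster_def using sym_rtrancl by (auto dest: symD)
qed

lemma cluster_eqI: "u \<in> cluster J w v \<Longrightarrow> cluster J w u = cluster J w v"
  using cluster_sym[of u w v] by (auto simp: cluster_def intro: rtrancl_trans)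

definition ghosted :: "('v set \<Rightarrow> bool) \<Rightarrow> 'v set \<Rightarrow> ennreal" where
  "ghosted g K = (if touches_green J g K then 1 else 0)"

definition live :: "('v set \<Rightarrow> bool) \<Rightarrow> 'v set \<Rightarrow> ennreal" where
  "live g K = (if finite K then ghosted g K else 0)"

text \<open>A cluster containing both endpoints counts once, so opening an edge between two finite
  green clusters lowers the count by one.\<close>

definition live_clusters :: "('v set \<Rightarrow> bool) \<Rightarrow> ('v set \<Rightarrow> bool) \<Rightarrow> 'v \<Rightarrow> 'v \<Rightarrow> ennreal" where
  "live_clusters w g x y = live g (cluster J w x)
     + (if cluster J w x = cluster J w y then 0 else live g (cluster J w y))"

lemma live_clusters_le: "live_clusters w g x y \<le> 2"
  by (auto simp: live_clusters_def live_def ghosted_def intro: order_trans[of _ 1])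

lemma cluster_open_edge:
  assumes "{x, y} \<in> E"
  shows "cluster J (w({x, y} := True)) x = cluster J (w({x, y} := False)) x \<union> cluster J (w({x, y} := False)) y"
proof -
  let ?e = "{x, y}"
  have "reach E (w(?e := True)) {x} = reach (E - {?e}) (w(?e := True)) ({x} \<union> ?e)"
    using assms by (intro reach_remove_open[symmetric]) auto
  also have "\<dots> = reach (E - {?e}) (w(?e := False)) ({x} \<union> {y})"
    by (simp add: reach_upd insert_commute)
  also have "\<dots> = reach E (w(?e := False)) ({x} \<union> {y})"
    by (rule reach_remove_closed) simp
  finally show ?thesis by (simp only: reach_Un cluster_eq_reach)
qed

text \<open>Opening the edge replaces the clusters \<open>A\<close>, \<open>B\<close> by their
  union. On the event, two finite green clusters become one live cluster, or a finite one is
  absorbed by an infinite one: either way one live cluster is lost. Off the event none is gained,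
  since a finite green union has a finite green part.\<close>

lemma live_clusters_open_closed:
  assumes "{x, y} \<in> E"
  shows "live_clusters (w({x, y} := True)) g x y + (if T_event J (w({x, y} := False)) g x y then 1 else 0)
    \<le> live_clusters (w({x, y} := False)) g x y"
proof -
  let ?e = "{x, y}"
  define A B where "A = cluster J (w(?e := False)) x" and "B = cluster J (w(?e := False)) y"
  have "cluster J (w(?e := True)) x = A \<union> B"
    unfolding A_def B_def by (rule cluster_open_edge[OF assms])
  moreover have "cluster J (w(?e := True)) y = B \<union> A"
    unfolding A_def B_def using cluster_open_edge[of y x w] assms by (simp add: insert_commute)
  ultimately have "live_clusters (w(?e := True)) g x y = live g (A \<union> B)"
    by (simp add: live_clusters_def Un_commute)
  moreover have "live_clusters (w(?e := False)) g x y = live g A + (if A = B then 0 else live g B)"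
    by (simp add: live_clusters_def A_def B_def)
  moreover have "T_event J (w(?e := False)) g x y \<longleftrightarrow> A \<noteq> B \<and> touches_green J g A \<and> touches_green J g B \<and> (finite A \<or> finite B)"
    by (simp add: T_event_def A_def B_def)
  ultimately show ?thesis
    by (auto simp: live_def ghosted_def touches_green_Un)
qed

text \<open>Mass sent from \<open>u\<close> to \<open>v\<close>: each edge at \<open>u\<close> that
  touches the cluster of \<open>v\<close> distributes \<open>c\<close> evenly over that cluster if
  it is green. An infinite cluster receives nothing because the inverse of its size is 0, which is
  why \<open>ghosted\<close> suffices in place of \<open>live\<close>.\<close>

definition share :: "('v set \<Rightarrow> ennreal) \<Rightarrow> ('v set \<Rightarrow> bool) \<Rightarrow> ('v set \<Rightarrow> bool) \<Rightarrow> 'v \<Rightarrow> 'v \<Rightarrow> ennreal" where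
  "share c w g u v = ghosted g (cluster J w v) * inverse (emeasure (count_space UNIV) (cluster J w v))
     * (\<integral>\<^sup>+y. c {u, y} * indicator {y. {u, y} \<inter> cluster J w v \<noteq> {}} y \<partial>count_space UNIV)"

lemma ghosted_normalised:
  "(\<integral>\<^sup>+v. ghosted g (cluster J w x) * inverse (emeasure (count_space UNIV) (cluster J w x))
      * indicator (cluster J w x) v \<partial>count_space UNIV) = live g (cluster J w x)"
proof (cases "finite (cluster J w x)")
  case True
  then have "card (cluster J w x) \<noteq> 0" using cluster_refl[of x w] by auto
  then show ?thesis using True
    by (subst nn_integral_cmult_indicator)
      (auto simp: live_def ghosted_def ennreal_inverse_of_nat)
next
  case False
  then show ?thesis by (subst nn_integral_cmult_indicator) (auto simp: live_def)
qed

text \<open>Within one live cluster the shares add up to 1, so an edge pays its mass once to each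
  distinct live cluster at its ends. This is the sending side of mass transport, the one that the
  merging inequality controls.\<close>

lemma nn_integral_share:
  "(\<integral>\<^sup>+v. share c w g u v \<partial>count_space UNIV) = (\<integral>\<^sup>+y. c {u, y} * live_clusters w g u y \<partial>count_space UNIV)"
proof -
  define s where "s v = ghosted g (cluster J w v) * inverse (emeasure (count_space UNIV) (cluster J w v))" for v
  have "(\<integral>\<^sup>+v. share c w g u v \<partial>count_space UNIV)
     = (\<integral>\<^sup>+v. \<integral>\<^sup>+y. s v * (c {u, y} * indicator {y. {u, y} \<inter> cluster J w v \<noteq> {}} y) \<partial>count_space UNIV \<partial>count_space UNIV)"
    by (simp add: share_def s_def nn_integral_cmult)
  also have "\<dots> = (\<integral>\<^sup>+y. \<integral>\<^sup>+v. s v * (c {u, y} * indicator {y. {u, y} \<inter> cluster J w v \<noteq> {}} y) \<partial>count_space UNIV \<partial>count_space UNIV)"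
    by (intro nn_integral_count_space_nn_integral) auto
  also have "\<dots> = (\<integral>\<^sup>+y. c {u, y} * (\<integral>\<^sup>+v. s u * indicator (cluster J w u) v
        + (if cluster J w u = cluster J w y then 0 else s y * indicator (cluster J w y) v) \<partial>count_space UNIV) \<partial>count_space UNIV)"
  proof (rule nn_integral_cong)
    fix y
    have "s v * (c {u, y} * indicator {y. {u, y} \<inter> cluster J w v \<noteq> {}} y)
       = c {u, y} * (s u * indicator (cluster J w u) v
        + (if cluster J w u = cluster J w y then 0 else s y * indicator (cluster J w y) v))" for v
    proof (cases "v \<in> cluster J w u")
      case True
      then have eq: "cluster J w v = cluster J w u" by (rule cluster_eqI)
      then show ?thesis
        using True cluster_refl[of u w] cluster_eqI[of v w y]
        by (auto simp: s_def mult_ac split: split_indicator)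
    next
      case False
      show ?thesis
      proof (cases "v \<in> cluster J w y")
        case True
        then have "cluster J w v = cluster J w y" by (rule cluster_eqI)
        then show ?thesis
          using True False cluster_refl[of y w] by (auto simp: s_def mult_ac split: split_indicator)
      next
        case False': False
        then have "\<not> {u, y} \<inter> cluster J w v \<noteq> {}"
          using False cluster_sym[of _ w v] by auto
        then show ?thesis using False False' by (auto split: split_indicator)
      qed
    qed
    then show "(\<integral>\<^sup>+v. s v * (c {u, y} * indicator {y. {u, y} \<inter> cluster J w v \<noteq> {}} y) \<partial>count_space UNIV)
      = c {u, y} * (\<integral>\<^sup>+v. s u * indicator (cluster J w u) v
        + (if cluster J w u = cluster J w y then 0 else s y * indicator (cluster J w y) v) \<partial>count_space UNIV)"
      by (simp add: nn_integral_cmult)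
  qed
  also have "\<dots> = (\<integral>\<^sup>+y. c {u, y} * live_clusters w g u y \<partial>count_space UNIV)"
    using ghosted_normalised[of g w]
    by (intro nn_integral_cong) (simp add: nn_integral_add live_clusters_def s_def)
  finally show ?thesis .
qed

end

section \<open>Balancing open against closed edges\<close>

text \<open>The two orientations of an edge: one of the factors 2 in the final constant.\<close>

lemma nn_integral_pairs_of_edge:
  fixes a b :: "'v::countable"
  assumes "a \<noteq> b"
  shows "(\<integral>\<^sup>+u. \<integral>\<^sup>+y. (if {u, y} = {a, b} then 1 else 0) \<partial>count_space UNIV \<partial>count_space UNIV) = (2::ennreal)"
proof -
  have "(if {u, y} = {a, b} then 1 else 0) = (indicator {a} u * indicator {b} y + indicator {b} u * indicator {a} y :: ennreal)" for u y
    using assms by (auto simp: doubleton_eq_iff split: split_indicator)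
  then show ?thesis
    by (simp add: nn_integral_add nn_integral_cmult)
qed

context wgraph
begin

section \<open>Measurability of cluster events\<close>

context
  fixes M :: "'a measure" and w :: "'a \<Rightarrow> 'v set \<Rightarrow> bool"
  assumes w: "\<And>e. e \<in> E \<Longrightarrow> Measurable.pred M (\<lambda>x. w x e)"
begin

text \<open>The measure and the random configuration are arbitrary, since these facts are applied
  both to \<open>U\<close> with a frozen environment and ghost field and to the joint law.\<close>

lemma pred_cluster [measurable]: "Measurable.pred M (\<lambda>x. z \<in> cluster J (w x) v)"
  unfolding cluster_eq_reach by (rule pred_reach) (rule w)

lemma borel_cluster_size [measurable]:
  "(\<lambda>x. emeasure (count_space UNIV) (cluster J (w x) v)) \<in> borel_measurable M"
proof -
  have "(\<lambda>x. \<integral>\<^sup>+z. (if z \<in> cluster J (w x) v then 1 else 0 :: ennreal) \<partial>count_space UNIV) \<in> borel_measurable M"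
    by (rule borel_nn_integral_countable) measurable
  also have "(\<lambda>x. \<integral>\<^sup>+z. (if z \<in> cluster J (w x) v then 1 else 0 :: ennreal) \<partial>count_space UNIV)
      = (\<lambda>x. emeasure (count_space UNIV) (cluster J (w x) v))"
  proof
    fix x
    have "(\<integral>\<^sup>+z. (if z \<in> cluster J (w x) v then 1 else 0 :: ennreal) \<partial>count_space UNIV)
       = (\<integral>\<^sup>+z. indicator (cluster J (w x) v) z \<partial>count_space UNIV)"
      by (intro nn_integral_cong) (auto split: split_indicator)
    then show "(\<integral>\<^sup>+z. (if z \<in> cluster J (w x) v then 1 else 0 :: ennreal) \<partial>count_space UNIV)
       = emeasure (count_space UNIV) (cluster J (w x) v)" by simp
  qed
  finally show ?thesis .
qed

lemma pred_finite_cluster [measurable]: "Measurable.pred M (\<lambda>x. finite (cluster J (w x) v))"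
proof -
  have "(\<lambda>x. finite (cluster J (w x) v)) = (\<lambda>x. emeasure (count_space UNIV) (cluster J (w x) v) < \<top>)"
    by (auto simp: emeasure_count_space fun_eq_iff of_nat_less_top)
  then show ?thesis by simp
qed

lemma pred_cluster_eq [measurable]: "Measurable.pred M (\<lambda>x. cluster J (w x) u = cluster J (w x) v)"
  unfolding set_eq_iff by measurable

context
  fixes g :: "'a \<Rightarrow> 'v set \<Rightarrow> bool"
  assumes g: "\<And>e. e \<in> E \<Longrightarrow> Measurable.pred M (\<lambda>x. g x e)"
begin

lemma pred_touches_green [measurable]: "Measurable.pred M (\<lambda>x. touches_green J (g x) (cluster J (w x) v))"
proof -
  have "Measurable.pred M (\<lambda>x. a \<in> cluster J (w x) v \<and> J {a, b} > 0 \<and> g x {a, b})" for a b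
  proof (cases "J {a, b} > 0")
    case True
    then have [measurable]: "Measurable.pred M (\<lambda>x. g x {a, b})" by (intro g) (simp add: edges_def)
    show ?thesis using True by simp
  qed simp
  then show ?thesis
    unfolding touches_green_iff[OF weighted] by (intro pred_intros_countable)
qed

lemma borel_ghosted [measurable]: "(\<lambda>x. ghosted (g x) (cluster J (w x) v)) \<in> borel_measurable M"
  unfolding ghosted_def by measurable

lemma borel_live_clusters [measurable]: "(\<lambda>x. live_clusters (w x) (g x) u v) \<in> borel_measurable M"
  unfolding live_clusters_def live_def by measurable

lemma pred_T_event [measurable]:
  assumes [measurable]: "Measurable.pred M (\<lambda>x. w x {u, v})"
  shows "Measurable.pred M (\<lambda>x. T_event J (w x) (g x) u v)"
  unfolding T_event_def by measurable

lemma borel_share: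
  fixes c :: "'a \<Rightarrow> 'v set \<Rightarrow> ennreal"
  assumes [measurable]: "\<And>e. (\<lambda>x. c x e) \<in> borel_measurable M"
  shows "(\<lambda>x. share (c x) (w x) (g x) u v) \<in> borel_measurable M"
proof -
  have "(\<lambda>x. c x {u, y} * indicator {y. {u, y} \<inter> cluster J (w x) v \<noteq> {}} y) \<in> borel_measurable M" for y
  proof -
    have "(\<lambda>x. c x {u, y} * indicator {y. {u, y} \<inter> cluster J (w x) v \<noteq> {}} y)
      = (\<lambda>x. if u \<in> cluster J (w x) v \<or> y \<in> cluster J (w x) v then c x {u, y} else 0)"
      by (auto simp: fun_eq_iff split: split_indicator)
    then show ?thesis by simp
  qed
  note [measurable] = borel_nn_integral_countable[OF this]
  show ?thesis unfolding share_def by measurable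
qed

end

end

definition closed_weight :: "real \<Rightarrow> ('v set \<Rightarrow> real) \<Rightarrow> ('v set \<Rightarrow> bool) \<Rightarrow> 'v set \<Rightarrow> ennreal" where
  "closed_weight \<epsilon> p w e = (if e \<in> E \<and> \<epsilon> \<le> J e \<and> \<not> w e then ennreal (beta (J e) (p e)) else 0)"

definition open_weight :: "real \<Rightarrow> ('v set \<Rightarrow> real) \<Rightarrow> ('v set \<Rightarrow> bool) \<Rightarrow> 'v set \<Rightarrow> ennreal" where
  "open_weight \<epsilon> p w e = (if e \<in> E \<and> \<epsilon> \<le> J e \<and> w e then ennreal (alpha (J e) (p e)) else 0)"

lemma borel_weights:
  assumes "\<And>e. e \<in> E \<Longrightarrow> Measurable.pred M (\<lambda>x. w x e)" "\<And>e. e \<in> E \<Longrightarrow> (\<lambda>x. p x e) \<in> borel_measurable M"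
  shows "(\<lambda>x. closed_weight \<epsilon> (p x) (w x) e) \<in> borel_measurable M"
    "(\<lambda>x. open_weight \<epsilon> (p x) (w x) e) \<in> borel_measurable M"
proof -
  show "(\<lambda>x. closed_weight \<epsilon> (p x) (w x) e) \<in> borel_measurable M"
  proof (cases "e \<in> E")
    case True
    note [measurable] = assms(1)[OF True] assms(2)[OF True]
    show ?thesis unfolding closed_weight_def beta_def by measurable
  qed (simp add: closed_weight_def)
  show "(\<lambda>x. open_weight \<epsilon> (p x) (w x) e) \<in> borel_measurable M"
  proof (cases "e \<in> E")
    case True
    note [measurable] = assms(1)[OF True] assms(2)[OF True]
    show ?thesis unfolding open_weight_def alpha_def by measurable
  qed (simp add: open_weight_def)
qed

text \<open>The edge weights are tuned so that opening and closing an edge balance; what remains is that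
  closing an edge of the event splits one live cluster into two.\<close>

lemma edge_inequality:
  assumes p: "\<And>e. e \<in> E \<Longrightarrow> 0 \<le> p e \<and> p e \<le> 1"
  shows "(\<integral>\<^sup>+u. (let w = \<lambda>e. u e \<le> p e in open_weight \<epsilon> p w {x, y} * live_clusters w g x y
            + (if T_event J w g x y then closed_weight \<epsilon> p w {x, y} else 0)) \<partial>U)
     \<le> (\<integral>\<^sup>+u. (let w = \<lambda>e. u e \<le> p e in closed_weight \<epsilon> p w {x, y} * live_clusters w g x y) \<partial>U)"
proof (cases "{x, y} \<in> E \<and> \<epsilon> \<le> J {x, y}")
  case False
  then have "open_weight \<epsilon> p w {x, y} = 0" "closed_weight \<epsilon> p w {x, y} = 0" for w
    by (auto simp: open_weight_def closed_weight_def)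
  then show ?thesis by (simp add: Let_def cong: if_cong)
next
  case True
  let ?e = "{x, y}"
  have e: "?e \<in> E" "\<epsilon> \<le> J ?e" "0 \<le> p ?e" "p ?e \<le> 1" using True p by auto
  define a where "a = ennreal (alpha (J ?e) (p ?e))"
  define b where "b = ennreal (beta (J ?e) (p ?e))"
  have ab: "ennreal (p ?e) * a = ennreal (1 - p ?e) * b"
    using alpha_beta[OF e(3,4) J_nonneg[of ?e]] e by (simp add: a_def b_def flip: ennreal_mult)
  define A where "A w = open_weight \<epsilon> p w ?e * live_clusters w g x y
      + (if T_event J w g x y then closed_weight \<epsilon> p w ?e else 0)" for w
  define B where "B w = closed_weight \<epsilon> p w ?e * live_clusters w g x y" for w
  have pred: "Measurable.pred U (\<lambda>u. u e \<le> p e)" if "e \<in> E" for e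
    using that by measurable
  have [measurable]: "(\<lambda>u. closed_weight \<epsilon> p (\<lambda>e. u e \<le> p e) f) \<in> borel_measurable U"
    "(\<lambda>u. open_weight \<epsilon> p (\<lambda>e. u e \<le> p e) f) \<in> borel_measurable U" for f
    using borel_weights[OF pred, where p = "\<lambda>_. p"] by auto
  have [measurable]: "(\<lambda>u. live_clusters (\<lambda>e. u e \<le> p e) g x y) \<in> borel_measurable U"
    by (rule borel_live_clusters[OF pred]) auto
  have [measurable]: "Measurable.pred U (\<lambda>u. T_event J (\<lambda>e. u e \<le> p e) g x y)"
    by (rule pred_T_event[OF pred]) (use e in simp_all)
  have "(\<integral>\<^sup>+u. A (\<lambda>e. u e \<le> p e) \<partial>U)
    = (\<integral>\<^sup>+u. ennreal (p ?e) * A ((\<lambda>f. u f \<le> p f)(?e := True)) + ennreal (1 - p ?e) * A ((\<lambda>f. u f \<le> p f)(?e := False)) \<partial>U)"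
    using e by (intro nn_integral_resample) (auto simp: A_def)
  also have "\<dots> \<le> (\<integral>\<^sup>+u. ennreal (p ?e) * B ((\<lambda>f. u f \<le> p f)(?e := True)) + ennreal (1 - p ?e) * B ((\<lambda>f. u f \<le> p f)(?e := False)) \<partial>U)"
  proof (rule nn_integral_mono)
    fix u
    define w where "w = (\<lambda>f. u f \<le> p f)"
    have A1: "A (w(?e := True)) = a * live_clusters (w(?e := True)) g x y"
      using e by (simp add: A_def open_weight_def closed_weight_def a_def)
    have A0: "A (w(?e := False)) = (if T_event J (w(?e := False)) g x y then b else 0)"
      using e by (simp add: A_def open_weight_def closed_weight_def b_def)
    have B1: "B (w(?e := True)) = 0"
      using e by (simp add: B_def closed_weight_def)
    have B0: "B (w(?e := False)) = b * live_clusters (w(?e := False)) g x y"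
      using e by (simp add: B_def closed_weight_def b_def)
    \<comment> \<open>By \<open>ab\<close> the open and the closed state share the factor
      \<open>(1 - p) * b\<close>. What remains after pulling it out is the deterministic comparison
      of cluster counts.\<close>
    have "ennreal (p ?e) * A (w(?e := True)) + ennreal (1 - p ?e) * A (w(?e := False))
      = ennreal (1 - p ?e) * b * (live_clusters (w(?e := True)) g x y + (if T_event J (w(?e := False)) g x y then 1 else 0))"
      unfolding A1 A0 by (simp add: ab distrib_left flip: mult.assoc)
    also have "\<dots> \<le> ennreal (1 - p ?e) * b * live_clusters (w(?e := False)) g x y"
      by (intro mult_left_mono live_clusters_open_closed e) auto
    also have "\<dots> = ennreal (p ?e) * B (w(?e := True)) + ennreal (1 - p ?e) * B (w(?e := False))"
      unfolding B1 B0 by (simp add: mult.assoc)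
    finally show "ennreal (p ?e) * A ((\<lambda>f. u f \<le> p f)(?e := True)) + ennreal (1 - p ?e) * A ((\<lambda>f. u f \<le> p f)(?e := False))
       \<le> ennreal (p ?e) * B ((\<lambda>f. u f \<le> p f)(?e := True)) + ennreal (1 - p ?e) * B ((\<lambda>f. u f \<le> p f)(?e := False))"
      unfolding w_def .
  qed
  also have "\<dots> = (\<integral>\<^sup>+u. B (\<lambda>e. u e \<le> p e) \<partial>U)"
    using e by (intro nn_integral_resample[symmetric]) (auto simp: B_def)
  finally show ?thesis by (simp add: A_def B_def Let_def)
qed

text \<open>The cut-off at work: the mean is at most \<open>sqrt (J e)\<close>, which need not be
  summable over the neighbours, but for \<open>\<epsilon> \<le> J e\<close> it is at most
  \<open>J e / sqrt \<epsilon>\<close>, which is.\<close>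

lemma nn_integral_open_weight_le:
  assumes p: "\<And>e. e \<in> E \<Longrightarrow> 0 \<le> p e \<and> p e \<le> 1" and "\<epsilon> > 0"
  shows "(\<integral>\<^sup>+u. open_weight \<epsilon> p (\<lambda>e. u e \<le> p e) e \<partial>U) \<le> ennreal (J e / sqrt \<epsilon>)"
proof (cases "e \<in> E \<and> \<epsilon> \<le> J e")
  case False
  then show ?thesis by (auto simp: open_weight_def)
next
  case True
  interpret prob_space U by (rule prob_space_U)
  have e: "e \<in> E" "\<epsilon> \<le> J e" "0 \<le> p e" "p e \<le> 1" using True p by auto
  have pred: "Measurable.pred U (\<lambda>u. u e \<le> p e)" if "e \<in> E" for e
    using that by measurable
  have [measurable]: "(\<lambda>u. open_weight \<epsilon> p (\<lambda>e. u e \<le> p e) f) \<in> borel_measurable U" for f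
    using borel_weights[OF pred, where p = "\<lambda>_. p"] by auto
  have "(\<integral>\<^sup>+u. open_weight \<epsilon> p (\<lambda>e. u e \<le> p e) e \<partial>U)
    = (\<integral>\<^sup>+u. ennreal (p e) * open_weight \<epsilon> p ((\<lambda>f. u f \<le> p f)(e := True)) e
        + ennreal (1 - p e) * open_weight \<epsilon> p ((\<lambda>f. u f \<le> p f)(e := False)) e \<partial>U)"
    using e by (intro nn_integral_resample) auto
  also have "\<dots> = ennreal (p e) * ennreal (alpha (J e) (p e))"
    using e by (simp add: open_weight_def emeasure_space_1)
  also have "\<dots> = ennreal (sqrt (J e * p e * (1 - p e)))"
    using alpha_beta[OF e(3,4) J_nonneg[of e]] e by (simp flip: ennreal_mult)
  also have "\<dots> \<le> ennreal (J e / sqrt \<epsilon>)"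
  proof (rule ennreal_leI)
    have "J e * p e * (1 - p e) \<le> J e * 1 * 1"
      using e J_nonneg[of e] by (intro mult_mono) auto
    then have "sqrt (J e * p e * (1 - p e)) \<le> sqrt (J e)" by simp
    also have "sqrt (J e) = J e / sqrt (J e)" by (simp add: real_div_sqrt J_nonneg)
    also have "\<dots> \<le> J e / sqrt \<epsilon>"
      using e \<open>\<epsilon> > 0\<close> J_nonneg[of e] by (intro divide_left_mono) auto
    finally show "sqrt (J e * p e * (1 - p e)) \<le> J e / sqrt \<epsilon>" .
  qed
  finally show ?thesis .
qed

text \<open>Agreement of \<open>w\<close> and \<open>g\<close> is asked on edges only, because
  \<open>act\<close> returns \<open>undefined\<close> elsewhere.\<close>

lemma share_equivariant:
  assumes aut: "is_aut J a"
    and w: "\<And>e. e \<in> E \<Longrightarrow> w' (a ` e) = w e" and g: "\<And>e. e \<in> E \<Longrightarrow> g' (a ` e) = g e"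
    and c: "\<And>e. c' (a ` e) = c e"
  shows "share c' w' g' (a u) (a v) = share c w g u v"
proof -
  have bij: "bij a" and J: "\<And>e. J (a ` e) = J e" using aut by (auto simp: is_aut_def)
  have inj: "inj a" using bij by (simp add: bij_def)
  have edge: "J {a x, a y} = J {x, y}" "c' {a x, a y} = c {x, y}"
    "J {x, y} > 0 \<Longrightarrow> w' {a x, a y} = w {x, y}" "J {x, y} > 0 \<Longrightarrow> g' {a x, a y} = g {x, y}" for x y
    using J[of "{x, y}"] c[of "{x, y}"] w[of "{x, y}"] g[of "{x, y}"] by (auto simp: edges_def)
  have rel: "(a x, a y) \<in> open_rel J w' \<longleftrightarrow> (x, y) \<in> open_rel J w" for x y
    using edge[of x y] by (auto simp: open_rel_def)
  have fwd: "(a x, a z) \<in> (open_rel J w')\<^sup>*" if "(x, z) \<in> (open_rel J w)\<^sup>*" for x z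
    using that by induction (auto intro: rtrancl_into_rtrancl simp: rel)
  have bwd: "(x, z) \<in> (open_rel J w)\<^sup>*" if "(a x, t) \<in> (open_rel J w')\<^sup>*" "t = a z" for x z t
    using that
  proof (induction arbitrary: z)
    case base
    then show ?case using inj by (auto simp: inj_eq)
  next
    case (step y t)
    obtain y' where "y = a y'" using bij by (metis bij_pointE)
    then show ?case using step rel[of y' z] by (auto intro: rtrancl_into_rtrancl)
  qed
  have mem: "a z \<in> cluster J w' (a v) \<longleftrightarrow> z \<in> cluster J w v" for z
    using fwd[of v z] bwd[of v "a z" z] by (auto simp: cluster_def)
  have image: "cluster J w' (a v) = a ` cluster J w v"
  proof (intro equalityI subsetI)
    fix t assume t: "t \<in> cluster J w' (a v)"
    obtain z where "t = a z" using bij by (metis bij_pointE)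
    then show "t \<in> a ` cluster J w v" using t mem by auto
  qed (use mem in auto)
  have size: "emeasure (count_space UNIV) (cluster J w' (a v)) = emeasure (count_space UNIV) (cluster J w v)"
    unfolding image using inj_on_subset[OF inj subset_UNIV, of "cluster J w v"]
    by (simp add: emeasure_count_space card_image finite_image_iff)
  have "touches_green J g' (cluster J w' (a v)) \<longleftrightarrow> touches_green J g (cluster J w v)"
  proof -
    have "(\<exists>x y. x \<in> cluster J w' (a v) \<and> J {x, y} > 0 \<and> g' {x, y})
      \<longleftrightarrow> (\<exists>x y. a x \<in> cluster J w' (a v) \<and> J {a x, a y} > 0 \<and> g' {a x, a y})"
      using bij by (metis bij_pointE)
    also have "\<dots> \<longleftrightarrow> (\<exists>x y. x \<in> cluster J w v \<and> J {x, y} > 0 \<and> g {x, y})"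
      unfolding mem edge(1) using edge(4) by blast
    finally show ?thesis by (simp add: touches_green_iff[OF weighted])
  qed
  then have ghost: "ghosted g' (cluster J w' (a v)) = ghosted g (cluster J w v)" by (simp add: ghosted_def)
  have "(\<integral>\<^sup>+y. c' {a u, y} * indicator {y. {a u, y} \<inter> cluster J w' (a v) \<noteq> {}} y \<partial>count_space UNIV)
     = (\<integral>\<^sup>+y. c' {a u, a y} * indicator {y. {a u, y} \<inter> cluster J w' (a v) \<noteq> {}} (a y) \<partial>count_space UNIV)"
    using bij by (intro nn_integral_bij_count_space[symmetric]) auto
  also have "\<dots> = (\<integral>\<^sup>+y. c {u, y} * indicator {y. {u, y} \<inter> cluster J w v \<noteq> {}} y \<partial>count_space UNIV)"
    by (intro nn_integral_cong) (auto simp: edge mem split: split_indicator)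
  finally show ?thesis
    by (simp add: share_def size ghost)
qed

end

section \<open>Mass received by a vertex, and the ghost field\<close>

context regular_wgraph
begin

text \<open>Each long edge touching the cluster sends its mass from both endpoints, and
  \<open>v\<close> gets the fraction \<open>1 / card\<close> of it.\<close>

lemma nn_integral_share_dual:
  assumes "finite (cluster J w v)" "\<epsilon> > 0" and r: "\<And>e. e \<in> E \<Longrightarrow> 0 \<le> r e"
    and c: "\<And>e. c e = (if e \<in> E \<and> \<epsilon> \<le> J e then ennreal (r e) else 0)"
  shows "(\<integral>\<^sup>+u. share c w g u v \<partial>count_space UNIV)
    = ghosted g (cluster J w v) * ennreal (2 * (\<Sum>e\<in>long_edges \<epsilon> (cluster J w v). r e) / card (cluster J w v))"
proof -
  define K where "K = cluster J w v"
  define L where "L = long_edges \<epsilon> K"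
  have "finite K" using assms by (simp add: K_def)
  have L: "finite L" unfolding L_def using \<open>finite K\<close> \<open>\<epsilon> > 0\<close> by (rule finite_long_edges)
  have k: "card K > 0" using \<open>finite K\<close> cluster_refl[of v w] by (auto simp: K_def card_gt_0_iff)
  have expand: "c {u, y} * indicator {y. {u, y} \<inter> K \<noteq> {}} y = (\<Sum>e\<in>L. ennreal (r e) * (if {u, y} = e then 1 else 0))" for u y
  proof (cases "{u, y} \<in> L")
    case True
    then have "c {u, y} * indicator {y. {u, y} \<inter> K \<noteq> {}} y = ennreal (r {u, y})"
      by (auto simp: L_def long_edges_def c split: split_indicator)
    then show ?thesis using True L by (simp add: if_distrib[of "\<lambda>t. _ * t"] sum.delta' cong: if_cong)
  next
    case False
    then have "c {u, y} * indicator {y. {u, y} \<inter> K \<noteq> {}} y = 0"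
      by (auto simp: L_def long_edges_def c split: split_indicator)
    moreover have "(\<Sum>e\<in>L. ennreal (r e) * (if {u, y} = e then 1 else 0)) = 0"
      using False by (intro sum.neutral) auto
    ultimately show ?thesis by simp
  qed
  have "(\<integral>\<^sup>+u. \<integral>\<^sup>+y. c {u, y} * indicator {y. {u, y} \<inter> K \<noteq> {}} y \<partial>count_space UNIV \<partial>count_space UNIV)
      = (\<Sum>e\<in>L. ennreal (r e) * (\<integral>\<^sup>+u. \<integral>\<^sup>+y. (if {u, y} = e then 1 else 0) \<partial>count_space UNIV \<partial>count_space UNIV))"
    unfolding expand by (simp add: nn_integral_sum nn_integral_cmult)
  also have "\<dots> = (\<Sum>e\<in>L. ennreal (r e) * 2)"
  proof (rule sum.cong[OF refl])
    fix e assume "e \<in> L"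
    then have "J e > 0" by (simp add: L_def long_edges_def edges_def)
    then obtain a b where "a \<noteq> b" "e = {a, b}" by (rule edgeE)
    then show "ennreal (r e) * (\<integral>\<^sup>+u. \<integral>\<^sup>+y. (if {u, y} = e then 1 else 0) \<partial>count_space UNIV \<partial>count_space UNIV) = ennreal (r e) * 2"
      using nn_integral_pairs_of_edge[of a b] by simp
  qed
  also have "\<dots> = (\<Sum>e\<in>L. ennreal (r e * 2))"
    by (intro sum.cong) (auto simp: ennreal_mult'')
  also have "\<dots> = ennreal (2 * sum r L)"
    using r by (subst sum_ennreal) (auto simp: L_def long_edges_def sum_distrib_left mult.commute)
  finally have total: "(\<integral>\<^sup>+u. \<integral>\<^sup>+y. c {u, y} * indicator {y. {u, y} \<inter> K \<noteq> {}} y \<partial>count_space UNIV \<partial>count_space UNIV) = ennreal (2 * sum r L)" .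
  have r0: "sum r L \<ge> 0" using r by (auto intro!: sum_nonneg simp: L_def long_edges_def)
  have "(\<integral>\<^sup>+u. share c w g u v \<partial>count_space UNIV) = ghosted g K * inverse (emeasure (count_space UNIV) K) * ennreal (2 * sum r L)"
    unfolding share_def K_def[symmetric] total[symmetric] by (rule nn_integral_cmult) simp
  also have "inverse (emeasure (count_space UNIV) K) = ennreal (1 / card K)"
    using \<open>finite K\<close> k by (simp add: ennreal_of_nat_eq_real_of_nat inverse_ennreal inverse_eq_divide)
  also have "ghosted g K * ennreal (1 / card K) * ennreal (2 * sum r L) = ghosted g K * ennreal (2 * sum r L / card K)"
    using r0 by (simp add: mult.assoc flip: ennreal_mult)
  finally show ?thesis by (simp add: K_def L_def)
qed

text \<open>Closed minus open received mass is \<open>2 * Z / card K\<close> with \<open>Z\<close>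
  the fluctuation. Subtraction in \<open>ennreal\<close> truncates at 0, so \<open>|Z|\<close> is an
  upper bound; infinite clusters receive nothing of either kind.\<close>

lemma share_difference_le:
  assumes p: "\<And>e. e \<in> E \<Longrightarrow> 0 \<le> p e \<and> p e \<le> 1" and "\<epsilon> > 0"
  shows "(\<integral>\<^sup>+u. share (closed_weight \<epsilon> p w) w g u v \<partial>count_space UNIV)
      - (\<integral>\<^sup>+u. share (open_weight \<epsilon> p w) w g u v \<partial>count_space UNIV)
    \<le> (if finite (cluster J w v) then ghosted g (cluster J w v) *
        ennreal (2 * \<bar>fluctuation \<epsilon> p w v\<bar> / card (cluster J w v)) else 0)"
proof (cases "finite (cluster J w v)")
  case False
  then have "share c w g u v = 0" for c u by (simp add: share_def)
  then show ?thesis by simp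
next
  case True
  define L where "L = long_edges \<epsilon> (cluster J w v)"
  define k where "k = real (card (cluster J w v))"
  define rc where "rc e = (if w e then 0 else beta (J e) (p e))" for e
  define ro where "ro e = (if w e then alpha (J e) (p e) else 0)" for e
  have r0: "0 \<le> rc e" "0 \<le> ro e" if "e \<in> E" for e
    using p[OF that] alpha_beta[of "p e" "J e"] J_nonneg[of e] by (auto simp: rc_def ro_def)
  have s: "(\<integral>\<^sup>+u. share (closed_weight \<epsilon> p w) w g u v \<partial>count_space UNIV) = ghosted g (cluster J w v) * ennreal (2 * sum rc L / k)"
    "(\<integral>\<^sup>+u. share (open_weight \<epsilon> p w) w g u v \<partial>count_space UNIV) = ghosted g (cluster J w v) * ennreal (2 * sum ro L / k)"
    unfolding L_def k_def using True \<open>\<epsilon> > 0\<close> r0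
    by (intro nn_integral_share_dual; auto simp: closed_weight_def open_weight_def rc_def ro_def)+
  have "fluctuation \<epsilon> p w v = sum rc L - sum ro L"
    unfolding fluctuation_def L_def sum_subtractf[symmetric]
    by (intro sum.cong) (auto simp: increment_def rc_def ro_def long_edges_def)
  moreover have "sum ro L \<ge> 0" using r0 by (auto intro!: sum_nonneg simp: L_def long_edges_def)
  ultimately have "ennreal (2 * sum rc L / k) - ennreal (2 * sum ro L / k) \<le> ennreal (2 * \<bar>fluctuation \<epsilon> p w v\<bar> / k)"
    using abs_ge_self[of "sum rc L - sum ro L"]
    by (subst ennreal_minus) (auto simp: k_def diff_divide_distrib[symmetric] intro!: ennreal_leI divide_right_mono simp del: abs_ge_self)
  then show ?thesis
    using True unfolding s k_def[symmetric] by (simp add: ghosted_def)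
qed

text \<open>Union bound over the edges at the vertices of \<open>K\<close>, using
  \<open>1 - exp (- x) \<le> x\<close>.\<close>

lemma nn_integral_ghosted_le:
  assumes "finite K" "h > 0"
  shows "(\<integral>\<^sup>+u. ghosted (\<lambda>e. u e \<le> 1 - exp (- h * J e)) K \<partial>U) \<le> ennreal (min 1 (h * d * card K))"
proof -
  interpret prob_space U by (rule prob_space_U)
  define q where "q e = 1 - exp (- h * J e)" for e
  have q: "0 \<le> q e" "q e \<le> 1" "q e \<le> h * J e" for e
    using J_nonneg[of e] \<open>h > 0\<close> exp_ge_add_one_self[of "- h * J e"] by (auto simp: q_def)
  have pred: "Measurable.pred U (\<lambda>u. u e \<le> q e)" if "e \<in> E" for e
    using that by measurable
  \<comment> \<open>The ghost field is itself a family of independent thresholded uniforms, so the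
    resampling identity applies with \<open>q\<close> in the role of the environment.\<close>
  have single: "(\<integral>\<^sup>+u. (if e \<in> E \<and> u e \<le> q e then 1 else 0) \<partial>U) \<le> ennreal (h * J e)" for e
  proof (cases "e \<in> E")
    case True
    have "(\<integral>\<^sup>+u. (if e \<in> E \<and> u e \<le> q e then 1 else 0) \<partial>U) = ennreal (q e)"
      using nn_integral_resample[of e q "\<lambda>w. if w e then 1 else 0"] True q pred[OF True]
      by (simp add: emeasure_space_1)
    then show ?thesis using q by (simp add: ennreal_leI)
  qed simp
  have meas: "(\<lambda>u. if {x, y} \<in> E \<and> u {x, y} \<le> q {x, y} then 1 else 0 :: ennreal) \<in> borel_measurable U" for x y
    using pred[of "{x, y}"] by (cases "{x, y} \<in> E") auto
  have "(\<integral>\<^sup>+u. ghosted (\<lambda>e. u e \<le> q e) K \<partial>U)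
    \<le> (\<integral>\<^sup>+u. (\<Sum>x\<in>K. \<integral>\<^sup>+y. (if {x, y} \<in> E \<and> u {x, y} \<le> q {x, y} then 1 else 0) \<partial>count_space UNIV) \<partial>U)"
  proof (rule nn_integral_mono)
    fix u
    show "ghosted (\<lambda>e. u e \<le> q e) K \<le> (\<Sum>x\<in>K. \<integral>\<^sup>+y. (if {x, y} \<in> E \<and> u {x, y} \<le> q {x, y} then 1 else 0) \<partial>count_space UNIV)"
    proof (cases "touches_green J (\<lambda>e. u e \<le> q e) K")
      case True
      then obtain x y where xy: "x \<in> K" "{x, y} \<in> E" "u {x, y} \<le> q {x, y}"
        unfolding touches_green_iff[OF weighted] by (auto simp: edges_def)
      have "1 = (\<integral>\<^sup>+z. indicator {y} z \<partial>count_space UNIV)" by simp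
      also have "\<dots> \<le> (\<integral>\<^sup>+y. (if {x, y} \<in> E \<and> u {x, y} \<le> q {x, y} then 1 else 0) \<partial>count_space UNIV)"
        using xy by (intro nn_integral_mono) (auto split: split_indicator)
      also have "\<dots> \<le> (\<Sum>x\<in>K. \<integral>\<^sup>+y. (if {x, y} \<in> E \<and> u {x, y} \<le> q {x, y} then 1 else 0) \<partial>count_space UNIV)"
        using xy \<open>finite K\<close> by (intro member_le_sum) auto
      finally show ?thesis by (simp add: ghosted_def)
    qed (simp add: ghosted_def)
  qed
  also have "\<dots> = (\<Sum>x\<in>K. \<integral>\<^sup>+u. \<integral>\<^sup>+y. (if {x, y} \<in> E \<and> u {x, y} \<le> q {x, y} then 1 else 0) \<partial>count_space UNIV \<partial>U)"
    using meas by (intro nn_integral_sum borel_nn_integral_countable)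
  also have "\<dots> = (\<Sum>x\<in>K. \<integral>\<^sup>+y. \<integral>\<^sup>+u. (if {x, y} \<in> E \<and> u {x, y} \<le> q {x, y} then 1 else 0) \<partial>U \<partial>count_space UNIV)"
    using meas by (intro sum.cong[OF refl] nn_integral_count_space_nn_integral) auto
  also have "\<dots> \<le> (\<Sum>x\<in>K. \<integral>\<^sup>+y. ennreal h * ennreal (J {x, y}) \<partial>count_space UNIV)"
    using single \<open>h > 0\<close> J_nonneg by (intro sum_mono nn_integral_mono) (auto simp flip: ennreal_mult)
  also have "\<dots> = (\<Sum>x\<in>K. ennreal (h * d))"
    using \<open>h > 0\<close> d_nonneg by (simp add: nn_integral_cmult nn_integral_degree ennreal_mult)
  also have "\<dots> = ennreal (h * d * card K)"
    using \<open>h > 0\<close> d_nonneg by (simp add: ennreal_of_nat_eq_real_of_nat mult.commute flip: ennreal_mult)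
  finally have 1: "(\<integral>\<^sup>+u. ghosted (\<lambda>e. u e \<le> q e) K \<partial>U) \<le> ennreal (h * d * card K)" .
  have "(\<integral>\<^sup>+u. ghosted (\<lambda>e. u e \<le> q e) K \<partial>U) \<le> (\<integral>\<^sup>+u. 1 \<partial>U)"
    by (intro nn_integral_mono) (auto simp: ghosted_def)
  then have "(\<integral>\<^sup>+u. ghosted (\<lambda>e. u e \<le> q e) K \<partial>U) \<le> ennreal 1" by (simp add: emeasure_space_1)
  with 1 show ?thesis unfolding q_def[symmetric] by (simp add: min_def)
qed

text \<open>The ghost field is independent of the configuration and can be averaged first, with the
  cluster frozen. The outcome has the form required by \<open>nn_integral_fluctuation_le\<close>
  with \<open>a = 1 / h\<close> and \<open>c = 4 * d\<close>.\<close>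

lemma nn_integral_ghosted_fluctuation_le:
  assumes p: "\<And>e. e \<in> E \<Longrightarrow> 0 \<le> p e \<and> p e \<le> 1" and "\<epsilon> > 0" "h > 0"
  shows "(\<integral>\<^sup>+u. \<integral>\<^sup>+t. (let w = \<lambda>e. u e \<le> p e; g = \<lambda>e. t e \<le> 1 - exp (- h * J e) in
       if finite (cluster J w v) then ghosted g (cluster J w v) *
        ennreal (2 * \<bar>fluctuation \<epsilon> p w v\<bar> / card (cluster J w v)) else 0) \<partial>U \<partial>U) \<le> ennreal (4 * d * sqrt h)"
proof -
  have "(\<integral>\<^sup>+t. (let w = \<lambda>e. u e \<le> p e; g = \<lambda>e. t e \<le> 1 - exp (- h * J e) in
       if finite (cluster J w v) then ghosted g (cluster J w v) *
        ennreal (2 * \<bar>fluctuation \<epsilon> p w v\<bar> / card (cluster J w v)) else 0) \<partial>U)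
     \<le> (let w = \<lambda>e. u e \<le> p e in
            if finite (cluster J w v) then ennreal (4 * d * \<bar>fluctuation \<epsilon> p w v\<bar> / (d * card (cluster J w v) + 1 / h)) else 0)" for u
  proof -
    define w where "w = (\<lambda>e. u e \<le> p e)"
    define K where "K = cluster J w v"
    define z where "z = \<bar>fluctuation \<epsilon> p w v\<bar>"
    show ?thesis
    proof (cases "finite K")
      case True
      define k where "k = real (card K)"
      have k: "k > 0" using True cluster_refl[of v w] by (auto simp: K_def k_def card_gt_0_iff)
      have pred: "Measurable.pred U (\<lambda>t. t e \<le> 1 - exp (- h * J e))" if "e \<in> E" for e
        using that by measurable
      have "(\<lambda>t. ghosted (\<lambda>e. t e \<le> 1 - exp (- h * J e)) K) \<in> borel_measurable U"
        unfolding K_def using borel_ghosted[where M = U and w = "\<lambda>_. w" and g = "\<lambda>t e. t e \<le> 1 - exp (- h * J e)" and v = v] pred by simp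
      then have "(\<integral>\<^sup>+t. ghosted (\<lambda>e. t e \<le> 1 - exp (- h * J e)) K * ennreal (2 * z / k) \<partial>U)
         = (\<integral>\<^sup>+t. ghosted (\<lambda>e. t e \<le> 1 - exp (- h * J e)) K \<partial>U) * ennreal (2 * z / k)"
        by (rule nn_integral_multc)
      also have "\<dots> \<le> ennreal (min 1 (h * d * k)) * ennreal (2 * z / k)"
        unfolding k_def by (intro mult_right_mono nn_integral_ghosted_le True \<open>h > 0\<close>) auto
      also have "\<dots> = ennreal (min 1 (h * d * k) * (2 * z / k))"
        using d_nonneg \<open>h > 0\<close> k by (simp add: z_def flip: ennreal_mult)
      also have "\<dots> \<le> ennreal (4 * d * z / (d * k + 1 / h))"
      proof (rule ennreal_leI)
        \<comment> \<open>With \<open>x = h * (d * k)\<close> this is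
          \<open>min 1 x * (x + 1) \<le> 2 * x\<close>. The choice \<open>a = 1 / h\<close> puts the
          crossover of the minimum where \<open>d * k = a\<close>.\<close>
        have *: "min 1 (h * (d * k)) * (d * k + 1 / h) \<le> 2 * (d * k)"
        proof (cases "h * (d * k) \<le> 1")
          case True
          then have "h * (d * k) * (d * k + 1 / h) = (h * (d * k)) * (d * k) + d * k"
            using \<open>h > 0\<close> by (simp add: field_simps)
          also have "\<dots> \<le> 1 * (d * k) + d * k"
            using True d_nonneg k by (intro add_right_mono mult_right_mono) auto
          finally show ?thesis using True by (simp add: min_def)
        next
          case False
          then have "1 / h \<le> d * k" using \<open>h > 0\<close> by (simp add: field_simps)
          then show ?thesis using False by (simp add: min_def)
        qed
        have pos: "d * k + 1 / h > 0" using d_nonneg k \<open>h > 0\<close> by (intro add_nonneg_pos) auto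
        have "min 1 (h * d * k) * (2 * z / k) = (min 1 (h * (d * k)) * (d * k + 1 / h)) * (2 * z / (k * (d * k + 1 / h)))"
          using pos k by (simp add: mult.assoc)
        also have "\<dots> \<le> 2 * (d * k) * (2 * z / (k * (d * k + 1 / h)))"
          using pos k by (intro mult_right_mono *) (auto simp: z_def)
        also have "\<dots> = 4 * d * z / (d * k + 1 / h)"
          using k pos by simp
        finally show "min 1 (h * d * k) * (2 * z / k) \<le> 4 * d * z / (d * k + 1 / h)" .
      qed
      finally show ?thesis using True
        by (simp add: Let_def flip: w_def) (simp add: k_def z_def flip: K_def)
    next
      case False
      then show ?thesis by (simp add: K_def w_def Let_def)
    qed
  qed
  then have "(\<integral>\<^sup>+u. \<integral>\<^sup>+t. (let w = \<lambda>e. u e \<le> p e; g = \<lambda>e. t e \<le> 1 - exp (- h * J e) in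
       if finite (cluster J w v) then ghosted g (cluster J w v) *
        ennreal (2 * \<bar>fluctuation \<epsilon> p w v\<bar> / card (cluster J w v)) else 0) \<partial>U \<partial>U)
    \<le> (\<integral>\<^sup>+u. (let w = \<lambda>e. u e \<le> p e in
            if finite (cluster J w v) then ennreal (4 * d * \<bar>fluctuation \<epsilon> p w v\<bar> / (d * card (cluster J w v) + 1 / h)) else 0) \<partial>U)"
    by (rule nn_integral_mono)
  also have "\<dots> \<le> ennreal (4 * d / sqrt (1 / h))"
    using assms d_nonneg by (intro nn_integral_fluctuation_le) auto
  also have "4 * d / sqrt (1 / h) = 4 * d * sqrt h"
    by (simp add: real_sqrt_divide)
  finally show ?thesis .
qed

end

section \<open>Percolation in an invariant environment\<close>

lemma nn_integral_triple:
  assumes "sigma_finite_measure B" "sigma_finite_measure C"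
    and f: "f \<in> borel_measurable (A \<Otimes>\<^sub>M (B \<Otimes>\<^sub>M C))"
  shows "(\<integral>\<^sup>+x. f x \<partial>(A \<Otimes>\<^sub>M (B \<Otimes>\<^sub>M C))) = (\<integral>\<^sup>+a. \<integral>\<^sup>+b. \<integral>\<^sup>+c. f (a, b, c) \<partial>C \<partial>B \<partial>A)"
proof -
  interpret pair_sigma_finite B C using assms by (simp add: pair_sigma_finite_def)
  note [measurable] = f
  have "(\<integral>\<^sup>+x. f x \<partial>(A \<Otimes>\<^sub>M (B \<Otimes>\<^sub>M C))) = (\<integral>\<^sup>+a. \<integral>\<^sup>+y. f (a, y) \<partial>(B \<Otimes>\<^sub>M C) \<partial>A)"
    by (rule nn_integral_fst[symmetric]) (rule f)
  also have "\<dots> = (\<integral>\<^sup>+a. \<integral>\<^sup>+b. \<integral>\<^sup>+c. f (a, b, c) \<partial>C \<partial>B \<partial>A)"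
    by (intro nn_integral_cong M2.nn_integral_fst[symmetric]) measurable
  finally show ?thesis .
qed

context wgraph
begin

lemma act_image:
  assumes "is_aut J a" "e \<in> E"
  shows "a ` e \<in> E" "act J a p (a ` e) = p e"
proof -
  show "a ` e \<in> E" using assms by (simp add: is_aut_def edges_def)
  moreover have "inv a ` a ` e = e" using assms by (simp add: is_aut_def bij_def image_comp)
  ultimately show "act J a p (a ` e) = p e" by (simp add: act_def)
qed

lemma distr_U_act:
  assumes "is_aut J a"
  shows "act J a \<in> measurable U U" "distr U U (act J a) = U"
proof -
  have a: "bij a" "\<And>e. J (a ` e) = J e" using assms by (auto simp: is_aut_def)
  have inv: "a ` inv a ` e = e" for e
    using a(1) by (simp add: image_comp bij_def surj_iff)
  have E: "inv a ` e \<in> E" if "e \<in> E" for e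
    using a(2)[of "inv a ` e"] that by (simp add: inv edges_def)
  show "act J a \<in> measurable U U"
    unfolding act_def unif_edges_def using E by (intro measurable_restrict) auto
  have "inj_on ((`) (inv a)) E"
    by (rule inj_on_inverseI[where g = "(`) a"]) (rule inv)
  then show "distr U U (act J a) = U"
    using distr_PiM_reindex[of E "\<lambda>_. \<nu>" "(`) (inv a)" E] prob_space_nu E
    by (auto simp: act_def[abs_def] unif_edges_def)
qed

end

locale percolation = regular_wgraph J d for J :: "'v::countable set \<Rightarrow> real" and d +
  fixes \<Gamma> :: "('v \<Rightarrow> 'v) set" and \<mu> :: "('v set \<Rightarrow> real) measure" and h :: real
  assumes connected: "connected_wg J" and subgroup: "closed_aut_subgroup J \<Gamma>"
    and transitive: "transitive_group \<Gamma>" and unimodular: "unimodular \<Gamma>"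
    and invariant: "invariant_env J \<Gamma> \<mu>" and h_pos: "h > 0"
begin

lemma aut: "a \<in> \<Gamma> \<Longrightarrow> is_aut J a"
  using subgroup by (auto simp: closed_aut_subgroup_def)

text \<open>Induction along a path from \<open>x\<close>: an element fixing \<open>x\<close> maps
  \<open>{y, z}\<close> to an edge of equal weight touching the orbit of \<open>y\<close>, and only
  finitely many such edges exist. Since \<open>card\<close> is 0 on infinite sets, the counting in
  \<open>mass_transport\<close> depends on this.\<close>

lemma finite_stab_orbit: "finite (stab_orbit \<Gamma> x y)"
proof -
  have "(x, y) \<in> (adj J)\<^sup>*" using connected by (simp add: connected_wg_def)
  then show ?thesis
  proof induction
    case base
    then show ?case by (rule finite_subset[of _ "{x}"]) (auto simp: stab_orbit_def)
  next
    case (step y z)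
    have J: "J {y, z} > 0" using step(2) by (simp add: adj_def)
    define L where "L = long_edges (J {y, z}) (stab_orbit \<Gamma> x y)"
    have L: "finite L" unfolding L_def by (rule finite_long_edges[OF step.IH J])
    have "stab_orbit \<Gamma> x z \<subseteq> \<Union>L"
    proof
      fix t assume "t \<in> stab_orbit \<Gamma> x z"
      then obtain a where a: "a \<in> \<Gamma>" "a x = x" "t = a z" by (auto simp: stab_orbit_def)
      have "J (a ` {y, z}) = J {y, z}" using aut[OF a(1)] by (simp only: is_aut_def)
      then have "{a y, a z} \<in> L"
        using a J by (auto simp: L_def long_edges_def edges_def stab_orbit_def)
      then show "t \<in> \<Union>L" using a by auto
    qed
    moreover have "finite (\<Union>L)"
    proof (rule finite_Union[OF L])
      fix e assume "e \<in> L"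
      then have "J e > 0" by (simp add: L_def long_edges_def edges_def)
      then show "finite e" by (rule edgeE) simp
    qed
    ultimately show ?case by (rule finite_subset)
  qed
qed

sublocale \<mu>: prob_space \<mu>
  using invariant by (simp add: invariant_env_def)

sublocale U: prob_space U
  by (rule prob_space_U)

lemma sets_mu: "sets \<mu> = sets (env_space J)" and space_mu: "space \<mu> = space (env_space J)"
  using invariant by (auto simp: invariant_env_def dest: sets_eq_imp_space_eq)

lemma env_range: "p \<in> space \<mu> \<Longrightarrow> e \<in> E \<Longrightarrow> 0 \<le> p e \<and> p e \<le> 1"
  by (auto simp: space_mu env_space_def space_PiM space_restrict_space)

lemma measurable_env_coordinate [measurable]: "(\<lambda>p. p e) \<in> borel_measurable \<mu>"
proof (cases "e \<in> E")
  case True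
  have "(\<lambda>p. p e) \<in> measurable (env_space J) (restrict_space borel {0..1})"
    unfolding env_space_def using True by (rule measurable_component_singleton)
  then have "(\<lambda>p. p e) \<in> borel_measurable (env_space J)"
    by (simp add: measurable_restrict_space2_iff)
  then show ?thesis by (simp add: measurable_cong_sets[OF sets_mu refl])
next
  case False
  have "(\<lambda>p. p e) \<in> borel_measurable \<mu> \<longleftrightarrow> (\<lambda>_. undefined :: real) \<in> borel_measurable \<mu>"
    by (rule measurable_cong, rule extensional_arb[OF _ False]) (simp add: space_mu env_space_def space_PiM PiE_def)
  then show ?thesis by simp
qed

text \<open>The random edge at the root is left out until the end, where it becomes a weighted sum
  over neighbours.\<close>

abbreviation P :: "(('v set \<Rightarrow> real) \<times> ('v set \<Rightarrow> real) \<times> ('v set \<Rightarrow> real)) measure" where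
  "P \<equiv> \<mu> \<Otimes>\<^sub>M (U \<Otimes>\<^sub>M U)"

definition config :: "('v set \<Rightarrow> real) \<times> ('v set \<Rightarrow> real) \<times> ('v set \<Rightarrow> real) \<Rightarrow> 'v set \<Rightarrow> bool" where
  "config = (\<lambda>(p, u, t) e. u e \<le> p e)"

definition green :: "('v set \<Rightarrow> real) \<times> ('v set \<Rightarrow> real) \<times> ('v set \<Rightarrow> real) \<Rightarrow> 'v set \<Rightarrow> bool" where
  "green = (\<lambda>(p, u, t) e. t e \<le> 1 - exp (- h * J e))"

lemma pred_config_P [measurable]: "Measurable.pred P (\<lambda>x. config x e)"
  unfolding config_def case_prod_beta' by measurable

lemma pred_green_P [measurable]: "Measurable.pred P (\<lambda>x. green x e)"
  unfolding green_def case_prod_beta' by measurable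

lemma borel_weights_P [measurable]:
  "(\<lambda>x. closed_weight \<epsilon> (fst x) (config x) e) \<in> borel_measurable P"
  "(\<lambda>x. open_weight \<epsilon> (fst x) (config x) e) \<in> borel_measurable P"
  by (intro borel_weights; measurable)+

lemma borel_live_clusters_P [measurable]:
  "(\<lambda>x. live_clusters (config x) (green x) u v) \<in> borel_measurable P"
  by (intro borel_live_clusters; measurable)

lemma pred_T_event_P [measurable]: "Measurable.pred P (\<lambda>x. T_event J (config x) (green x) u v)"
  by (intro pred_T_event; measurable)

lemma borel_share_P [measurable]:
  "(\<lambda>x. share (closed_weight \<epsilon> (fst x) (config x)) (config x) (green x) u v) \<in> borel_measurable P"
  "(\<lambda>x. share (open_weight \<epsilon> (fst x) (config x)) (config x) (green x) u v) \<in> borel_measurable P"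
  by (intro borel_share; measurable)+

text \<open>Two orders of integration: ghost field innermost to average it over a frozen cluster,
  edge variables innermost to resample an edge under a frozen ghost field.\<close>

lemma nn_integral_P:
  assumes f: "f \<in> borel_measurable P"
  shows "(\<integral>\<^sup>+x. f x \<partial>P) = (\<integral>\<^sup>+p. \<integral>\<^sup>+u. \<integral>\<^sup>+t. f (p, u, t) \<partial>U \<partial>U \<partial>\<mu>)"
    "(\<integral>\<^sup>+x. f x \<partial>P) = (\<integral>\<^sup>+p. \<integral>\<^sup>+t. \<integral>\<^sup>+u. f (p, u, t) \<partial>U \<partial>U \<partial>\<mu>)"
proof -
  interpret UU: pair_sigma_finite U U ..
  note [measurable] = f
  show 1: "(\<integral>\<^sup>+x. f x \<partial>P) = (\<integral>\<^sup>+p. \<integral>\<^sup>+u. \<integral>\<^sup>+t. f (p, u, t) \<partial>U \<partial>U \<partial>\<mu>)"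
    by (intro nn_integral_triple f) unfold_locales
  show "(\<integral>\<^sup>+x. f x \<partial>P) = (\<integral>\<^sup>+p. \<integral>\<^sup>+t. \<integral>\<^sup>+u. f (p, u, t) \<partial>U \<partial>U \<partial>\<mu>)"
    unfolding 1 by (intro nn_integral_cong UU.Fubini') measurable
qed

definition push :: "('v \<Rightarrow> 'v) \<Rightarrow> ('v set \<Rightarrow> real) \<times> ('v set \<Rightarrow> real) \<times> ('v set \<Rightarrow> real)
    \<Rightarrow> ('v set \<Rightarrow> real) \<times> ('v set \<Rightarrow> real) \<times> ('v set \<Rightarrow> real)" where
  "push a = (\<lambda>(p, u, t). (act J a p, act J a u, act J a t))"

lemma distr_push:
  assumes a: "a \<in> \<Gamma>"
  shows "push a \<in> measurable P P" "distr P P (push a) = P"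
proof -
  note U = distr_U_act[OF aut[OF a]]
  have inv: "a ` inv a ` e = e" for e
    using aut[OF a] by (simp add: is_aut_def image_comp bij_def surj_iff)
  have E: "inv a ` e \<in> E" if "e \<in> E" for e
    using aut[OF a] that inv[of e] by (auto simp: is_aut_def edges_def) metis
  have "act J a \<in> measurable (env_space J) (env_space J)"
    unfolding act_def env_space_def using E by (intro measurable_restrict measurable_component_singleton) auto
  then have m: "act J a \<in> measurable \<mu> \<mu>"
    by (simp add: measurable_cong_sets[OF sets_mu sets_mu])
  have "distr \<mu> (env_space J) (act J a) = \<mu>" using invariant a by (simp add: invariant_env_def)
  then have d: "distr \<mu> \<mu> (act J a) = \<mu>" using distr_cong[OF refl sets_mu, of \<mu> "act J a" "act J a"] by simp
  have sf: "sigma_finite_measure U" "sigma_finite_measure (U \<Otimes>\<^sub>M U)"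
  proof -
    interpret UU: pair_sigma_finite U U ..
    show "sigma_finite_measure U" "sigma_finite_measure (U \<Otimes>\<^sub>M U)" by unfold_locales
  qed
  define push2 where "push2 = (\<lambda>(u, t). (act J a u, act J a t))"
  have m2: "push2 \<in> measurable (U \<Otimes>\<^sub>M U) (U \<Otimes>\<^sub>M U)"
    unfolding push2_def using U(1) by measurable
  have d2: "distr (U \<Otimes>\<^sub>M U) (U \<Otimes>\<^sub>M U) push2 = U \<Otimes>\<^sub>M U"
    using pair_measure_distr[OF U(1) U(1)] sf unfolding U(2) push2_def by simp
  have push: "push a = (\<lambda>(p, y). (act J a p, push2 y))"
    by (auto simp: push_def push2_def fun_eq_iff)
  show "push a \<in> measurable P P"
    unfolding push using m m2 by measurable
  show "distr P P (push a) = P"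
    using pair_measure_distr[OF m m2] sf unfolding d2 d push by simp
qed

lemma push_config:
  assumes "a \<in> \<Gamma>" "e \<in> E"
  shows "config (push a x) (a ` e) = config x e" "green (push a x) (a ` e) = green x e"
    "fst (push a x) (a ` e) = fst x e"
  using act_image[OF aut[OF assms(1)] assms(2)] aut[OF assms(1)]
  by (auto simp: config_def green_def push_def is_aut_def split: prod.splits)

text \<open>The expected share is a diagonally invariant kernel, since \<open>push a\<close>
  preserves the joint law and moves shares along.\<close>

lemma transport:
  fixes c :: "('v set \<Rightarrow> real) \<times> ('v set \<Rightarrow> real) \<times> ('v set \<Rightarrow> real) \<Rightarrow> 'v set \<Rightarrow> ennreal"
  assumes c: "\<And>a e x. a \<in> \<Gamma> \<Longrightarrow> c (push a x) (a ` e) = c x e"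
    and meas [measurable]: "\<And>e. (\<lambda>x. c x e) \<in> borel_measurable P"
  shows "(\<integral>\<^sup>+x. \<integral>\<^sup>+v. share (c x) (config x) (green x) z v \<partial>count_space UNIV \<partial>P)
    = (\<integral>\<^sup>+x. \<integral>\<^sup>+u. share (c x) (config x) (green x) u z \<partial>count_space UNIV \<partial>P)"
proof -
  define f where "f u v x = share (c x) (config x) (green x) u v" for u v x
  have [measurable]: "f u v \<in> borel_measurable P" for u v
    unfolding f_def by (intro borel_share; measurable)
  define F where "F u v = (\<integral>\<^sup>+x. f u v x \<partial>P)" for u v
  have "F (a u) (a v) = F u v" if a: "a \<in> \<Gamma>" for a u v
  proof -
    have "F (a u) (a v) = (\<integral>\<^sup>+x. f (a u) (a v) x \<partial>distr P P (push a))"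
      by (simp add: F_def distr_push[OF a])
    also have "\<dots> = (\<integral>\<^sup>+x. f (a u) (a v) (push a x) \<partial>P)"
      by (intro nn_integral_distr distr_push[OF a]) measurable
    also have "\<dots> = F u v"
      unfolding F_def f_def
      by (intro nn_integral_cong share_equivariant aut a push_config c)
    finally show ?thesis .
  qed
  then have "(\<integral>\<^sup>+v. F z v \<partial>count_space UNIV) = (\<integral>\<^sup>+u. F u z \<partial>count_space UNIV)"
    using subgroup transitive unimodular finite_stab_orbit
    by (intro mass_transport[of \<Gamma>]) (auto simp: closed_aut_subgroup_def is_aut_def)
  then show ?thesis
    unfolding F_def f_def[symmetric] by (simp add: nn_integral_count_space_nn_integral)
qed

lemma transport_weights:
  "(\<integral>\<^sup>+x. \<integral>\<^sup>+v. share (closed_weight \<epsilon> (fst x) (config x)) (config x) (green x) z v \<partial>count_space UNIV \<partial>P)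
    = (\<integral>\<^sup>+x. \<integral>\<^sup>+u. share (closed_weight \<epsilon> (fst x) (config x)) (config x) (green x) u z \<partial>count_space UNIV \<partial>P)"
  "(\<integral>\<^sup>+x. \<integral>\<^sup>+v. share (open_weight \<epsilon> (fst x) (config x)) (config x) (green x) z v \<partial>count_space UNIV \<partial>P)
    = (\<integral>\<^sup>+x. \<integral>\<^sup>+u. share (open_weight \<epsilon> (fst x) (config x)) (config x) (green x) u z \<partial>count_space UNIV \<partial>P)"
proof -
  have "a ` e \<in> E \<longleftrightarrow> e \<in> E" "J (a ` e) = J e" if "a \<in> \<Gamma>" for a e
    using aut[OF that] by (auto simp: is_aut_def edges_def)
  then have "closed_weight \<epsilon> (fst (push a x)) (config (push a x)) (a ` e) = closed_weight \<epsilon> (fst x) (config x) e"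
    "open_weight \<epsilon> (fst (push a x)) (config (push a x)) (a ` e) = open_weight \<epsilon> (fst x) (config x) e"
    if "a \<in> \<Gamma>" for a e x
    using push_config[OF that, of e x] that by (auto simp: closed_weight_def open_weight_def)
  then show "(\<integral>\<^sup>+x. \<integral>\<^sup>+v. share (closed_weight \<epsilon> (fst x) (config x)) (config x) (green x) z v \<partial>count_space UNIV \<partial>P)
    = (\<integral>\<^sup>+x. \<integral>\<^sup>+u. share (closed_weight \<epsilon> (fst x) (config x)) (config x) (green x) u z \<partial>count_space UNIV \<partial>P)"
  "(\<integral>\<^sup>+x. \<integral>\<^sup>+v. share (open_weight \<epsilon> (fst x) (config x)) (config x) (green x) z v \<partial>count_space UNIV \<partial>P)
    = (\<integral>\<^sup>+x. \<integral>\<^sup>+u. share (open_weight \<epsilon> (fst x) (config x)) (config x) (green x) u z \<partial>count_space UNIV \<partial>P)"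
    by (intro transport; measurable)+
qed

section \<open>Expected weight of the cut edges at the root\<close>

definition cut_weight :: "real \<Rightarrow> 'v \<Rightarrow> 'v \<Rightarrow> ('v set \<Rightarrow> real) \<times> ('v set \<Rightarrow> real) \<times> ('v set \<Rightarrow> real) \<Rightarrow> ennreal" where
  "cut_weight \<epsilon> z y x = (if T_event J (config x) (green x) z y then closed_weight \<epsilon> (fst x) (config x) {z, y} else 0)"

lemma borel_cut_weight [measurable]: "cut_weight \<epsilon> z y \<in> borel_measurable P"
  unfolding cut_weight_def[abs_def] by measurable

lemma edge_inequality_P:
  "(\<integral>\<^sup>+x. open_weight \<epsilon> (fst x) (config x) {z, y} * live_clusters (config x) (green x) z y + cut_weight \<epsilon> z y x \<partial>P)
   \<le> (\<integral>\<^sup>+x. closed_weight \<epsilon> (fst x) (config x) {z, y} * live_clusters (config x) (green x) z y \<partial>P)"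
proof -
  have "(\<integral>\<^sup>+u. open_weight \<epsilon> p (config (p, u, t)) {z, y} * live_clusters (config (p, u, t)) (green (p, u, t)) z y + cut_weight \<epsilon> z y (p, u, t) \<partial>U)
    \<le> (\<integral>\<^sup>+u. closed_weight \<epsilon> p (config (p, u, t)) {z, y} * live_clusters (config (p, u, t)) (green (p, u, t)) z y \<partial>U)"
    if "p \<in> space \<mu>" for p t
    \<comment> \<open>\<open>green\<close> ignores its second component, so \<open>undefined\<close>
      is a mere placeholder there.\<close>
    using edge_inequality[of p \<epsilon> z y "green (p, undefined, t)"] env_range[OF that]
    by (simp add: Let_def config_def green_def cut_weight_def cong: if_cong)
  then show ?thesis
    by (subst (1 2) nn_integral_P(2), measurable) (simp add: nn_integral_mono)
qed

lemma open_total_finite: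
  assumes "\<epsilon> > 0"
  shows "(\<integral>\<^sup>+x. \<integral>\<^sup>+y. open_weight \<epsilon> (fst x) (config x) {z, y} * live_clusters (config x) (green x) z y \<partial>count_space UNIV \<partial>P) < \<top>"
proof -
  have *: "(\<integral>\<^sup>+x. open_weight \<epsilon> (fst x) (config x) {z, y} \<partial>P) \<le> ennreal (1 / sqrt \<epsilon>) * ennreal (J {z, y})" for y
  proof -
    have "(\<integral>\<^sup>+x. open_weight \<epsilon> (fst x) (config x) {z, y} \<partial>P)
       = (\<integral>\<^sup>+p. \<integral>\<^sup>+t. \<integral>\<^sup>+u. open_weight \<epsilon> p (\<lambda>e. u e \<le> p e) {z, y} \<partial>U \<partial>U \<partial>\<mu>)"
      using nn_integral_P(2)[OF borel_weights_P(2)[of \<epsilon> "{z, y}"]] by (simp add: config_def)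
    also have "\<dots> \<le> (\<integral>\<^sup>+p. \<integral>\<^sup>+t. ennreal (J {z, y} / sqrt \<epsilon>) \<partial>U \<partial>\<mu>)"
      using env_range \<open>\<epsilon> > 0\<close> by (intro nn_integral_mono nn_integral_open_weight_le) auto
    also have "\<dots> = ennreal (J {z, y} / sqrt \<epsilon>)"
      by (simp add: U.emeasure_space_1 \<mu>.emeasure_space_1)
    also have "\<dots> = ennreal (1 / sqrt \<epsilon>) * ennreal (J {z, y})"
      using J_nonneg \<open>\<epsilon> > 0\<close> by (simp flip: ennreal_mult)
    finally show ?thesis .
  qed
  have "(\<integral>\<^sup>+x. \<integral>\<^sup>+y. open_weight \<epsilon> (fst x) (config x) {z, y} * live_clusters (config x) (green x) z y \<partial>count_space UNIV \<partial>P)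
    \<le> (\<integral>\<^sup>+x. \<integral>\<^sup>+y. open_weight \<epsilon> (fst x) (config x) {z, y} * 2 \<partial>count_space UNIV \<partial>P)"
    by (intro nn_integral_mono mult_left_mono live_clusters_le) simp
  also have "\<dots> = (\<integral>\<^sup>+y. (\<integral>\<^sup>+x. open_weight \<epsilon> (fst x) (config x) {z, y} \<partial>P) * 2 \<partial>count_space UNIV)"
    by (subst nn_integral_count_space_nn_integral) (auto simp: nn_integral_multc)
  also have "\<dots> \<le> (\<integral>\<^sup>+y. ennreal (1 / sqrt \<epsilon>) * ennreal (J {z, y}) * 2 \<partial>count_space UNIV)"
    by (intro nn_integral_mono mult_right_mono *) simp
  also have "\<dots> = ennreal (1 / sqrt \<epsilon>) * ennreal d * 2"
    by (simp add: nn_integral_multc nn_integral_cmult nn_integral_degree)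
  also have "\<dots> < \<top>"
    by (simp add: ennreal_mult_less_top)
  finally show ?thesis .
qed

lemma dual_difference_le:
  assumes "\<epsilon> > 0"
  shows "(\<integral>\<^sup>+x. (\<integral>\<^sup>+u. share (closed_weight \<epsilon> (fst x) (config x)) (config x) (green x) u z \<partial>count_space UNIV)
      - (\<integral>\<^sup>+u. share (open_weight \<epsilon> (fst x) (config x)) (config x) (green x) u z \<partial>count_space UNIV) \<partial>P)
    \<le> ennreal (4 * d * sqrt h)" (is "(\<integral>\<^sup>+x. ?D x \<partial>P) \<le> _")
proof -
  have [measurable]: "?D \<in> borel_measurable P"
    by (intro borel_measurable_minus_ennreal borel_nn_integral_countable borel_share_P)
  have "(\<integral>\<^sup>+x. ?D x \<partial>P) = (\<integral>\<^sup>+p. \<integral>\<^sup>+u. \<integral>\<^sup>+t. ?D (p, u, t) \<partial>U \<partial>U \<partial>\<mu>)"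
    by (rule nn_integral_P(1)) measurable
  also have "\<dots> \<le> (\<integral>\<^sup>+p. ennreal (4 * d * sqrt h) \<partial>\<mu>)"
  proof (rule nn_integral_mono)
    fix p assume p: "p \<in> space \<mu>"
    have "(\<integral>\<^sup>+u. \<integral>\<^sup>+t. ?D (p, u, t) \<partial>U \<partial>U) \<le>
      (\<integral>\<^sup>+u. \<integral>\<^sup>+t. (let w = \<lambda>e. u e \<le> p e; g = \<lambda>e. t e \<le> 1 - exp (- h * J e) in
       if finite (cluster J w z) then ghosted g (cluster J w z) *
        ennreal (2 * \<bar>fluctuation \<epsilon> p w z\<bar> / card (cluster J w z)) else 0) \<partial>U \<partial>U)"
      unfolding Let_def config_def green_def fst_conv case_prod_conv
      using env_range[OF p] \<open>\<epsilon> > 0\<close> by (intro nn_integral_mono share_difference_le)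
    also have "\<dots> \<le> ennreal (4 * d * sqrt h)"
      using env_range[OF p] \<open>\<epsilon> > 0\<close> h_pos by (intro nn_integral_ghosted_fluctuation_le)
    finally show "(\<integral>\<^sup>+u. \<integral>\<^sup>+t. ?D (p, u, t) \<partial>U \<partial>U) \<le> ennreal (4 * d * sqrt h)" .
  qed
  also have "\<dots> = ennreal (4 * d * sqrt h)"
    by (simp add: \<mu>.emeasure_space_1)
  finally show ?thesis .
qed

text \<open>Nothing is subtracted, as finiteness of \<open>Cl\<close> is not known in advance: cut
  weight plus \<open>Op\<close> is bounded by \<open>Cl\<close>, which is bounded by
  \<open>Op\<close> plus the fluctuation term, and \<open>Op\<close> is cancelled last.\<close>

lemma nn_integral_cut_weight_le:
  assumes "\<epsilon> > 0"
  shows "(\<integral>\<^sup>+x. \<integral>\<^sup>+y. cut_weight \<epsilon> z y x \<partial>count_space UNIV \<partial>P) \<le> ennreal (4 * d * sqrt h)"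
proof -
  define n where "n y x = live_clusters (config x) (green x) z y" for y x
  define Op where "Op = (\<integral>\<^sup>+x. \<integral>\<^sup>+y. open_weight \<epsilon> (fst x) (config x) {z, y} * n y x \<partial>count_space UNIV \<partial>P)"
  define Cl where "Cl = (\<integral>\<^sup>+x. \<integral>\<^sup>+y. closed_weight \<epsilon> (fst x) (config x) {z, y} * n y x \<partial>count_space UNIV \<partial>P)"
  define sc where "sc x = (\<integral>\<^sup>+u. share (closed_weight \<epsilon> (fst x) (config x)) (config x) (green x) u z \<partial>count_space UNIV)" for x
  define so where "so x = (\<integral>\<^sup>+u. share (open_weight \<epsilon> (fst x) (config x)) (config x) (green x) u z \<partial>count_space UNIV)" for x
  have [measurable]: "n y \<in> borel_measurable P" for y unfolding n_def by measurable
  have [measurable]: "sc \<in> borel_measurable P" "so \<in> borel_measurable P"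
    unfolding sc_def so_def by (intro borel_nn_integral_countable borel_share_P)+
  have "(\<integral>\<^sup>+x. \<integral>\<^sup>+y. cut_weight \<epsilon> z y x \<partial>count_space UNIV \<partial>P) + Op
     = (\<integral>\<^sup>+y. \<integral>\<^sup>+x. cut_weight \<epsilon> z y x \<partial>P \<partial>count_space UNIV)
       + (\<integral>\<^sup>+y. \<integral>\<^sup>+x. open_weight \<epsilon> (fst x) (config x) {z, y} * n y x \<partial>P \<partial>count_space UNIV)"
    unfolding Op_def by (subst (1 2) nn_integral_count_space_nn_integral) auto
  also have "\<dots> = (\<integral>\<^sup>+y. \<integral>\<^sup>+x. open_weight \<epsilon> (fst x) (config x) {z, y} * n y x + cut_weight \<epsilon> z y x \<partial>P \<partial>count_space UNIV)"
    by (simp add: nn_integral_add add.commute)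
  also have "\<dots> \<le> (\<integral>\<^sup>+y. \<integral>\<^sup>+x. closed_weight \<epsilon> (fst x) (config x) {z, y} * n y x \<partial>P \<partial>count_space UNIV)"
    unfolding n_def by (intro nn_integral_mono edge_inequality_P)
  also have "\<dots> = Cl"
    unfolding Cl_def by (subst nn_integral_count_space_nn_integral) auto
  \<comment> \<open>From here on the mass sent by \<open>z\<close> is replaced by the mass that
    \<open>z\<close> receives.\<close>
  also have "Cl = (\<integral>\<^sup>+x. sc x \<partial>P)"
    unfolding Cl_def n_def sc_def nn_integral_share[symmetric] by (rule transport_weights)
  \<comment> \<open>Only an inequality, because the truncated difference is 0 where
    \<open>so\<close> exceeds \<open>sc\<close>.\<close>
  also have "\<dots> \<le> (\<integral>\<^sup>+x. so x + (sc x - so x) \<partial>P)"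
    by (intro nn_integral_mono) (metis add.commute ennreal_ineq_diff_add nle_le diff_add_cancel_ennreal add_increasing2 zero_le)
  also have "\<dots> = (\<integral>\<^sup>+x. so x \<partial>P) + (\<integral>\<^sup>+x. sc x - so x \<partial>P)"
    by (intro nn_integral_add) measurable
  also have "(\<integral>\<^sup>+x. so x \<partial>P) = Op"
    unfolding Op_def n_def so_def nn_integral_share[symmetric] by (rule transport_weights(2)[symmetric])
  also have "(\<integral>\<^sup>+x. sc x - so x \<partial>P) \<le> ennreal (4 * d * sqrt h)"
    unfolding sc_def so_def by (rule dual_difference_le[OF assms])
  finally have "Op + (\<integral>\<^sup>+x. \<integral>\<^sup>+y. cut_weight \<epsilon> z y x \<partial>count_space UNIV \<partial>P) \<le> Op + ennreal (4 * d * sqrt h)"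
    by (simp add: add.commute add_left_mono)
  moreover have "Op < \<top>"
    unfolding Op_def n_def by (rule open_total_finite[OF assms])
  ultimately show ?thesis
    by (auto simp: ennreal_add_left_cancel_le)
qed

text \<open>The bound is uniform in \<open>\<epsilon>\<close>, and for each single edge the cut-off
  is eventually inactive. Fatou's lemma is applied over the neighbours and then over
  \<open>P\<close>.\<close>

lemma nn_integral_cut_weight_0_le:
  "(\<integral>\<^sup>+x. \<integral>\<^sup>+y. cut_weight 0 z y x \<partial>count_space UNIV \<partial>P) \<le> ennreal (4 * d * sqrt h)"
proof -
  define \<epsilon> where "\<epsilon> n = 1 / real (Suc n)" for n
  have "cut_weight 0 z y x \<le> liminf (\<lambda>n. cut_weight (\<epsilon> n) z y x)" for y x
  proof (cases "{z, y} \<in> E")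
    case True
    then have "J {z, y} > 0" by (simp add: edges_def)
    then obtain m where m: "1 / real (Suc m) < J {z, y}" using nat_approx_posE by blast
    have "\<forall>\<^sub>F n in sequentially. cut_weight 0 z y x \<le> cut_weight (\<epsilon> n) z y x"
    proof (rule eventually_sequentiallyI[of m])
      fix n assume "m \<le> n"
      then have "\<epsilon> n \<le> 1 / real (Suc m)" unfolding \<epsilon>_def by (intro divide_left_mono) auto
      then have "\<epsilon> n \<le> J {z, y}" using m by simp
      then show "cut_weight 0 z y x \<le> cut_weight (\<epsilon> n) z y x"
        by (simp add: cut_weight_def closed_weight_def)
    qed
    then show ?thesis by (rule Liminf_bounded)
  qed (simp add: cut_weight_def closed_weight_def)
  then have "(\<integral>\<^sup>+x. \<integral>\<^sup>+y. cut_weight 0 z y x \<partial>count_space UNIV \<partial>P)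
     \<le> (\<integral>\<^sup>+x. \<integral>\<^sup>+y. liminf (\<lambda>n. cut_weight (\<epsilon> n) z y x) \<partial>count_space UNIV \<partial>P)"
    by (intro nn_integral_mono)
  also have "\<dots> \<le> (\<integral>\<^sup>+x. liminf (\<lambda>n. \<integral>\<^sup>+y. cut_weight (\<epsilon> n) z y x \<partial>count_space UNIV) \<partial>P)"
    by (intro nn_integral_mono nn_integral_liminf) simp
  also have "\<dots> \<le> liminf (\<lambda>n. \<integral>\<^sup>+x. \<integral>\<^sup>+y. cut_weight (\<epsilon> n) z y x \<partial>count_space UNIV \<partial>P)"
    by (intro nn_integral_liminf borel_nn_integral_countable borel_cut_weight)
  also have "\<dots> \<le> ennreal (4 * d * sqrt h)"
    by (intro order_trans[OF Liminf_le_Limsup Limsup_bounded] always_eventually allI nn_integral_cut_weight_le)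
      (auto simp: \<epsilon>_def)
  finally show ?thesis .
qed

section \<open>The random edge at the root\<close>

lemma nn_integral_eta:
  "(\<integral>\<^sup>+y. f y \<partial>eta_law J z) = (\<integral>\<^sup>+y. ennreal (J {z, y} / d) * f y \<partial>count_space UNIV)"
  unfolding eta_law_def degree by (rule nn_integral_density) auto

lemma E_muh_le:
  "E_muh J z \<mu> h (\<lambda>p w g y. if T_event J w g z y
              then ennreal (if p {z, y} = 1 then 0 else sqrt (p {z, y} / ((1 - p {z, y}) * J {z, y})))
              else 0) \<le> ennreal (4 * sqrt h)" (is "E_muh J z \<mu> h ?F \<le> _")
proof -
  define \<eta> where "\<eta> = eta_law J z"
  have sets_eta: "sets \<eta> = UNIV" by (simp add: \<eta>_def eta_law_def)
  \<comment> \<open>Only finiteness is claimed: for \<open>d = 0\<close> the law of the edge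
    degenerates to the zero measure.\<close>
  have "emeasure \<eta> (space \<eta>) = (\<integral>\<^sup>+y. 1 \<partial>\<eta>)" by simp
  also have "\<dots> = (\<integral>\<^sup>+y. ennreal (1 / d) * ennreal (J {z, y}) \<partial>count_space UNIV)"
    unfolding \<eta>_def nn_integral_eta using d_nonneg J_nonneg by (simp flip: ennreal_mult)
  also have "\<dots> < \<top>"
    by (simp add: nn_integral_cmult nn_integral_degree ennreal_mult_less_top)
  finally interpret \<eta>: finite_measure \<eta> by (intro finite_measureI) simp
  define f where "f y x = ?F (fst x) (config x) (green x) y" for y x
  have f[measurable]: "f y \<in> borel_measurable P" for y
    unfolding f_def by measurable
  have sf: "sigma_finite_measure U" "sigma_finite_measure \<eta>" "sigma_finite_measure (U \<Otimes>\<^sub>M \<eta>)"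
    using U.sigma_finite_measure_axioms \<eta>.sigma_finite_measure_axioms by (auto intro: sigma_finite_pair_measure)
  have [measurable]: "(\<lambda>v. snd (snd (snd v))) \<in> measurable (\<mu> \<Otimes>\<^sub>M (U \<Otimes>\<^sub>M (U \<Otimes>\<^sub>M \<eta>))) (count_space UNIV)"
  proof -
    have "(\<lambda>v. snd (snd (snd v))) \<in> measurable (\<mu> \<Otimes>\<^sub>M (U \<Otimes>\<^sub>M (U \<Otimes>\<^sub>M \<eta>))) \<eta>" by measurable
    moreover have "sets (count_space UNIV) = sets \<eta>" using sets_eta by simp
    ultimately show ?thesis using measurable_cong_sets by blast
  qed
  have meas: "(\<lambda>v. f (snd (snd (snd v))) (fst v, fst (snd v), fst (snd (snd v)))) \<in> borel_measurable (\<mu> \<Otimes>\<^sub>M (U \<Otimes>\<^sub>M (U \<Otimes>\<^sub>M \<eta>)))"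
    by (rule measurable_compose_countable[where g = "\<lambda>v. snd (snd (snd v))"]) measurable
  have "E_muh J z \<mu> h ?F = (\<integral>\<^sup>+v. f (snd (snd (snd v))) (fst v, fst (snd v), fst (snd (snd v))) \<partial>(\<mu> \<Otimes>\<^sub>M (U \<Otimes>\<^sub>M (U \<Otimes>\<^sub>M \<eta>))))"
    unfolding E_muh_def f_def \<eta>_def config_def green_def by (simp add: case_prod_beta' cong: if_cong)
  also have "\<dots> = (\<integral>\<^sup>+p. \<integral>\<^sup>+u. \<integral>\<^sup>+r. f (snd r) (p, u, fst r) \<partial>(U \<Otimes>\<^sub>M \<eta>) \<partial>U \<partial>\<mu>)"
    by (subst nn_integral_triple[OF sf(1,3) meas]) simp
  also have "\<dots> = (\<integral>\<^sup>+p. \<integral>\<^sup>+u. \<integral>\<^sup>+t. \<integral>\<^sup>+y. f y (p, u, t) \<partial>\<eta> \<partial>U \<partial>U \<partial>\<mu>)"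
  proof (intro nn_integral_cong)
    fix p u assume pu: "p \<in> space \<mu>" "u \<in> space U"
    have "(\<lambda>r. (p, u, r)) \<in> measurable (U \<Otimes>\<^sub>M \<eta>) (\<mu> \<Otimes>\<^sub>M (U \<Otimes>\<^sub>M (U \<Otimes>\<^sub>M \<eta>)))"
      using pu by measurable
    from measurable_compose[OF this meas]
    show "(\<integral>\<^sup>+r. f (snd r) (p, u, fst r) \<partial>(U \<Otimes>\<^sub>M \<eta>)) = (\<integral>\<^sup>+t. \<integral>\<^sup>+y. f y (p, u, t) \<partial>\<eta> \<partial>U)"
      by (subst \<eta>.nn_integral_fst[symmetric]) simp_all
  qed
  also have "\<dots> = (\<integral>\<^sup>+p. \<integral>\<^sup>+u. \<integral>\<^sup>+t. \<integral>\<^sup>+y. ennreal (J {z, y} / d) * f y (p, u, t) \<partial>count_space UNIV \<partial>U \<partial>U \<partial>\<mu>)"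
    unfolding \<eta>_def nn_integral_eta ..
  also have "\<dots> = (\<integral>\<^sup>+x. \<integral>\<^sup>+y. ennreal (J {z, y} / d) * f y x \<partial>count_space UNIV \<partial>P)"
    by (rule nn_integral_P(1)[symmetric]) (intro borel_nn_integral_countable, measurable)
  also have "\<dots> \<le> (\<integral>\<^sup>+x. \<integral>\<^sup>+y. ennreal (1 / d) * cut_weight 0 z y x \<partial>count_space UNIV \<partial>P)"
  proof (intro nn_integral_mono)
    fix x y assume "x \<in> space P"
    then have "fst x \<in> space \<mu>" by (auto simp: space_pair_measure)
    define j where "j = J {z, y}"
    define t where "t = fst x {z, y}"
    show "ennreal (J {z, y} / d) * f y x \<le> ennreal (1 / d) * cut_weight 0 z y x"
    proof (cases "J {z, y} > 0 \<and> T_event J (config x) (green x) z y \<and> fst x {z, y} \<noteq> 1")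
      case True
      have t: "0 \<le> t" "t < 1" using env_range[OF \<open>fst x \<in> space \<mu>\<close>, of "{z, y}"] True
        by (auto simp: edges_def t_def)
      have j: "j > 0" using True by (simp add: j_def)
      have "j * sqrt (t / ((1 - t) * j)) = sqrt (j * j) * sqrt (t / ((1 - t) * j))"
        using j by simp
      also have "\<dots> = sqrt (j * j * (t / ((1 - t) * j)))" by (simp only: real_sqrt_mult)
      also have "j * j * (t / ((1 - t) * j)) = j * t / (1 - t)" using j t by (simp add: field_simps)
      finally have "j / d * sqrt (t / ((1 - t) * j)) = 1 / d * beta j t" by (simp add: beta_def)
      moreover have "f y x = ennreal (sqrt (t / ((1 - t) * j)))"
        using True by (simp add: f_def t_def j_def)
      moreover have "cut_weight 0 z y x = ennreal (beta j t)"
        using True by (simp add: cut_weight_def closed_weight_def T_event_def edges_def t_def j_def)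
      ultimately show ?thesis
        using j t d_nonneg alpha_beta(5)[of t j] unfolding j_def[symmetric] by (simp flip: ennreal_mult del: mult_cancel_left times_divide_eq_left)
    next
      \<comment> \<open>Either \<open>J = 0\<close> and the weight vanishes, or the event fails, or
        \<open>p = 1\<close> and the convention of the theorem gives 0.\<close>
      case False
      then show ?thesis
        using J_nonneg[of "{z, y}"] by (auto simp: f_def less_le)
    qed
  qed
  also have "\<dots> = ennreal (1 / d) * (\<integral>\<^sup>+x. \<integral>\<^sup>+y. cut_weight 0 z y x \<partial>count_space UNIV \<partial>P)"
    by (simp add: nn_integral_cmult borel_nn_integral_countable)
  also have "\<dots> \<le> ennreal (1 / d) * ennreal (4 * d * sqrt h)"
    by (intro mult_left_mono nn_integral_cut_weight_0_le) simp
  also have "\<dots> = ennreal (1 / d * (4 * d * sqrt h))"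
    using d_nonneg h_pos by (simp flip: ennreal_mult)
  \<comment> \<open>An inequality rather than an equation because of \<open>d = 0\<close>, where the
    left side is 0.\<close>
  also have "\<dots> \<le> ennreal (4 * sqrt h)"
    using h_pos by (intro ennreal_leI) auto
  finally show ?thesis .
qed

end

lemma degree_constant:
  assumes "weighted_graph J" "transitive_wg J"
  shows "(\<Sum>\<^sub>\<infinity>y. J {v, y}) = (\<Sum>\<^sub>\<infinity>y. J {u, y})"
proof -
  obtain a where a: "is_aut J a" "a v = u"
    using assms(2) by (auto simp: transitive_wg_def transitive_group_def)
  then have "J {v, y} = J {u, a y}" for y
    unfolding is_aut_def by (metis image_empty image_insert)
  then show ?thesis
    using infsum_reindex_bij_betw[of a UNIV UNIV "\<lambda>y. J {u, y}"] a by (simp add: is_aut_def)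
qed

theorem theorem3p1:
  fixes J :: "'v::countable set \<Rightarrow> real"
    and \<Gamma> :: "('v \<Rightarrow> 'v) set"
    and \<mu> :: "('v set \<Rightarrow> real) measure"
    and x0 :: 'v
    and h :: real
  assumes "weighted_graph J"
    and "connected_wg J"
    and "transitive_wg J"
    and "closed_aut_subgroup J \<Gamma>"
    and "transitive_group \<Gamma>"
    and "unimodular \<Gamma>"
    and "invariant_env J \<Gamma> \<mu>"
    and "h > 0"
  shows "E_muh J x0 \<mu> h
           (\<lambda>p \<omega> green y. if T_event J \<omega> green x0 y
              then ennreal (if p {x0, y} = 1 then 0
                            else sqrt (p {x0, y} / ((1 - p {x0, y}) * J {x0, y})))
              else 0)
         \<le> ennreal (21 * sqrt h)"
proof -
  interpret percolation J "\<Sum>\<^sub>\<infinity>y. J {x0, y}" \<Gamma> \<mu> h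
    using assms by unfold_locales (auto intro: degree_constant)
  show ?thesis
    \<comment> \<open>The argument yields the constant 4, well below 21.\<close>
    using assms(8) by (intro order_trans[OF E_muh_le] ennreal_leI) simp
qed

end
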